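(* Let $A$ be an integral domain and let $K$ be its field of fractions. Suppose that there exists a non-trivial absolute value $|\cdot|$ on $K$ such that $|a|\ge 1$ for every $a\in A\setminus\{0\}$, and let $\overline{K}$ denote the completion of $K$ with respect to this absolute value. Let $\gamma=(1+\sqrt{5})/2$. (a) Suppose that $A$ is a unique factorization domain. Then, for every $\xi\in\overline{K}$ such that $1$, $\xi$ and $\xi^2$ are linearly independent over $K$, there exist a constant $c_1>0$ and arbitrarily large real numbers $X$ such that the inequalities $$|x_0|\le X \quad\text{and}\quad \max\{|x_0\xi-x_1|,\,|x_0\xi^2-x_2|\}\le c_1X^{-1/\gamma}$$ have no non-zero solution $(x_0,x_1,x_2)\in A^3$. (That is, there is a constant $c_1>0$ such that the set of real numbers $X>0$ for which these inequalities have no non-zero solution in $A^3$ is unbounded.) (b) (Without assuming that $A$ is a unique factorization domain.) There exist $\xi\in\overline{K}$ such that $1$, $\xi$ and $\xi^2$ are linearly independent over $K$ and a constant $c_2>0$ such that, for every sufficiently large real number $X$, the inequalities $$|x_0|\le X \quad\text{and}\quad \max\{|x_0\xi-x_1|,\,|x_0\xi^2-x_2|\}\le c_2X^{-1/\gamma}$$ have a non-zero solution $(x_0,x_1,x_2)\in A^3$.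
   Context: Here $\overline{K}$ denotes the completion of $K$ for the absolute value $|\cdot|$ (not an algebraic closure), and $|\cdot|$ also denotes the extension of the absolute value to $\overline{K}$ by continuity. The absolute value is real-valued, multiplicative and satisfies the triangle inequality; it may be archimedean or non-archimedean. A solution $(x_0,x_1,x_2)$ is non-zero if it is different from $(0,0,0)$. *)

theory Defs
  imports
    "HOL-Analysis.Analysis"
    "HOL-Library.Multiset"
    "HOL-Computational_Algebra.Polynomial_Factorial"
begin

(* The library's class factorial_semiring adds a chosen normalisation to the ring, so it cannot
   serve as a hypothesis on a given integral domain. Mutual divisibility means being associated. *)
definition unique_factorization_domain :: "'a::idom itself \<Rightarrow> bool" where
  "unique_factorization_domain _ \<longleftrightarrow>
     (\<forall>x::'a. x \<noteq> 0 \<and> \<not> x dvd 1 \<longrightarrow>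
        (\<exists>P. (\<forall>p\<in>#P. irreducible p) \<and> prod_mset P = x)) \<and>
     (\<forall>P Q :: 'a multiset.
        (\<forall>p\<in>#P. irreducible p) \<and> (\<forall>q\<in>#Q. irreducible q) \<and> prod_mset P = prod_mset Q \<longrightarrow>
        rel_mset (\<lambda>p q. p dvd q \<and> q dvd p) P Q)"

definition absolute_value :: "('k::field \<Rightarrow> real) \<Rightarrow> bool" where
  "absolute_value v \<longleftrightarrow>
     (\<forall>x. v x \<ge> 0) \<and>
     (\<forall>x. v x = 0 \<longleftrightarrow> x = 0) \<and>
     (\<forall>x y. v (x * y) = v x * v y) \<and>
     (\<forall>x y. v (x + y) \<le> v x + v y)"

definition nontrivial_absolute_value :: "('k::field \<Rightarrow> real) \<Rightarrow> bool" where
  "nontrivial_absolute_value v \<longleftrightarrow> absolute_value v \<and> (\<exists>x. x \<noteq> 0 \<and> v x \<noteq> 1)"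

definition field_embedding :: "('k::field \<Rightarrow> 'c::field) \<Rightarrow> bool" where
  "field_embedding \<iota> \<longleftrightarrow>
     \<iota> 1 = 1 \<and> (\<forall>x y. \<iota> (x + y) = \<iota> x + \<iota> y) \<and> (\<forall>x y. \<iota> (x * y) = \<iota> x * \<iota> y)"

(* The field 'c with absolute value w and embedding \<iota> is a completion of ('k, v); such a
   triple is unique up to a unique isometric isomorphism over 'k. Since w is an absolute value
   and \<iota> has dense image, w is the extension of v by continuity. *)
definition completion_of ::
    "('k::field \<Rightarrow> real) \<Rightarrow> ('k \<Rightarrow> 'c::field) \<Rightarrow> ('c \<Rightarrow> real) \<Rightarrow> bool" where
  "completion_of v \<iota> w \<longleftrightarrow>
     field_embedding \<iota> \<and> absolute_value w \<and> (\<forall>x. w (\<iota> x) = v x) \<and>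
     Metric_space.mcomplete UNIV (\<lambda>y z. w (y - z)) \<and>
     Metric_space.mtopology UNIV (\<lambda>y z. w (y - z)) closure_of (range \<iota>) = UNIV"

(* Independence of the family, not of the set {1, \<xi>, \<xi>^2}: coinciding members are dependent. *)
definition lin_indep_1_xi_xi2 :: "('k::field \<Rightarrow> 'c::field) \<Rightarrow> 'c \<Rightarrow> bool" where
  "lin_indep_1_xi_xi2 \<iota> \<xi> \<longleftrightarrow>
     (\<forall>a b c. \<iota> a * 1 + \<iota> b * \<xi> + \<iota> c * \<xi>^2 = 0 \<longrightarrow> a = 0 \<and> b = 0 \<and> c = 0)"

definition golden_ratio :: real where
  "golden_ratio = (1 + sqrt 5) / 2"

definition has_nonzero_solution ::
    "('a::idom fract \<Rightarrow> 'c::field) \<Rightarrow> ('c \<Rightarrow> real) \<Rightarrow> 'c \<Rightarrow> real \<Rightarrow> real \<Rightarrow> bool" where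
  "has_nonzero_solution \<iota> w \<xi> c X \<longleftrightarrow>
     (\<exists>x0 x1 x2 :: 'a. (x0, x1, x2) \<noteq> (0, 0, 0) \<and>
        w (\<iota> (to_fract x0)) \<le> X \<and>
        max (w (\<iota> (to_fract x0) * \<xi> - \<iota> (to_fract x1)))
            (w (\<iota> (to_fract x0) * \<xi>^2 - \<iota> (to_fract x2)))
          \<le> c * X powr (- 1 / golden_ratio))"

end

theory Submission
  imports Defs
begin

text \<open>
  (a) Let $c$ be small and suppose that there is a solution for every large $X$. Minimal points need
  not exist, since the set of heights $|x_0|$ can have accumulation points; near-minimal points (up to
  a factor 2) serve instead. They give a sequence $y_k$ of points of heights $H_k$ and errors
  $L_k \<le> 16 c H_{k+1}^{-1/\<gamma>}$, consecutive points being independent. For infinitely many $k$ three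
  consecutive points have a non-zero determinant, whence $1 \<le> 10 H_{k+2} L_{k+1} L_k$. Unique
  factorization enters only in showing that $y_{k+1}$ does not lie on the conic $x_0 x_2 = x_1^2$,
  whence $1 \<le> C H_{k+1} L_{k+1}$. Together these bound $c$ from below.

  (b) Following Roy, identify $(x_0,x_1,x_2)$ with the symmetric matrix with rows $(x_0,x_1)$ and
  $(x_1,x_2)$ and set $x_{k+2} = x_{k+1} S_k x_k$, where $S_k$ alternates between a non-symmetric
  matrix and its transpose; this makes every $x_k$ symmetric with determinant $\<plusminus>1$. The ratios
  $x_{k,1}/x_{k,0}$ converge to some $\<xi>$ with error $O(|x_{k,0}|^{-2})$, while
  $|x_{k+2,0}|$ is of the order of $|x_{k+1,0}| |x_{k,0}|$, so that $|x_{k+1,0}|$ is of the order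
  of $|x_{k,0}|^\<gamma>$.
\<close>

subsection \<open>Conics over a unique factorization domain\<close>

text \<open>
  The library versions of the next two lemmas need \<^class>\<open>algebraic_semidom\<close>, hence a division
  operation, which an arbitrary integral domain does not carry.
\<close>

lemma prime_elem_dvd_prod_mset_idom:
  fixes p :: "'a::idom"
  assumes "prime_elem p" and "p dvd prod_mset Q"
  shows "\<exists>q\<in>#Q. p dvd q"
  using assms(2)
proof (induction Q)
  case empty
  then show ?case using assms(1) by (simp add: prime_elem_def)
next
  case (add q Q)
  then show ?case using prime_elem_dvd_multD[OF assms(1), of q "prod_mset Q"] by auto
qed

lemma irreducible_mult_unit_idom:
  fixes p :: "'a::idom"
  assumes "irreducible p" and "u dvd 1"
  shows "irreducible (p * u)"
  unfolding irreducible_def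
proof (intro conjI allI impI)
  show "p * u \<noteq> 0" using assms by (auto simp: irreducible_def)
  show "\<not> p * u dvd 1" using assms(1) by (auto simp: irreducible_def dest: dvd_mult_left)
  fix a b assume ab: "p * u = a * b"
  obtain v where "u * v = 1" using assms(2) by (metis dvdE)
  hence "p = a * (b * v)" using ab by (metis mult.assoc mult_1_right)
  hence "a dvd 1 \<or> b * v dvd 1" using assms(1) by (rule irreducibleD[rotated])
  then show "a dvd 1 \<or> b dvd 1" by (auto dest: dvd_mult_left)
qed

lemma ufd_factorization:
  fixes x :: "'a::idom"
  assumes "unique_factorization_domain TYPE('a)" and "x \<noteq> 0"
  obtains u P where "u dvd 1" "\<forall>p\<in>#P. irreducible p" "x = u * prod_mset P"
proof (cases "x dvd 1")
  case True
  then show thesis using that[of x "{#}"] by simp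
next
  case False
  then show thesis
    using assms that[of 1] unfolding unique_factorization_domain_def by auto
qed

text \<open>An equation a * b = p * c gives two factorizations of one element; uniqueness pairs
  \<open>p\<close>, up to associates, with an irreducible factor of \<open>a\<close> or of
  \<open>b\<close>.\<close>

lemma ufd_irreducible_imp_prime_elem:
  fixes p :: "'a::idom"
  assumes ufd: "unique_factorization_domain TYPE('a)" and irr: "irreducible p"
  shows "prime_elem p"
proof (rule prime_elemI)
  show "p \<noteq> 0" "\<not> p dvd 1"
    using irr by (auto simp: irreducible_def)
next
  fix a b assume "p dvd a * b"
  then obtain c where c: "a * b = p * c" by (elim dvdE)
  show "p dvd a \<or> p dvd b"
  proof (cases "a = 0 \<or> b = 0")
    case False
    hence "c \<noteq> 0" using c by auto
    obtain ua P where P: "ua dvd 1" "\<forall>p\<in>#P. irreducible p" "a = ua * prod_mset P"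
      using False by (blast intro: ufd_factorization[OF ufd])
    obtain ub Q where Q: "ub dvd 1" "\<forall>p\<in>#Q. irreducible p" "b = ub * prod_mset Q"
      using False by (blast intro: ufd_factorization[OF ufd])
    obtain uc R where R: "uc dvd 1" "\<forall>p\<in>#R. irreducible p" "c = uc * prod_mset R"
      using \<open>c \<noteq> 0\<close> by (blast intro: ufd_factorization[OF ufd])
    obtain va where va: "ua * va = 1" using P(1) by (metis dvdE)
    obtain vb where vb: "ub * vb = 1" using Q(1) by (metis dvdE)
    \<comment> \<open>The units of all three factorizations are absorbed into \<open>p\<close>, so
      that both sides become pure products of irreducibles.\<close>
    define u where "u = uc * va * vb"
    have u: "u dvd 1"
      using mult_dvd_mono[OF mult_dvd_mono[OF R(1) dvdI[OF va[symmetric, unfolded mult.commute[of ua]]]]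
          dvdI[OF vb[symmetric, unfolded mult.commute[of ub]]]]
      unfolding u_def by simp
    have "prod_mset P * prod_mset Q = (va * vb) * (a * b)"
      unfolding P(3) Q(3) using va vb by (metis (no_types, lifting) mult.assoc mult.commute mult_1)
    also have "\<dots> = (p * u) * prod_mset R"
      unfolding c R(3) u_def by (simp add: ac_simps)
    finally have "prod_mset (add_mset (p * u) R) = prod_mset (P + Q)" by simp
    moreover have "irreducible (p * u)"
      using irr u by (rule irreducible_mult_unit_idom)
    moreover have "\<forall>P Q :: 'a multiset.
        (\<forall>p\<in>#P. irreducible p) \<and> (\<forall>q\<in>#Q. irreducible q) \<and> prod_mset P = prod_mset Q \<longrightarrow>
        rel_mset (\<lambda>p q. p dvd q \<and> q dvd p) P Q"
      using ufd unfolding unique_factorization_domain_def by (rule conjunct2)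
    moreover have "\<forall>q\<in>#P + Q. irreducible q" using P(2) Q(2) by auto
    ultimately have "rel_mset (\<lambda>p q. p dvd q \<and> q dvd p) (add_mset (p * u) R) (P + Q)"
      using R(2) by simp
    then obtain N q where N: "P + Q = add_mset q N" "p * u dvd q"
      by (auto dest!: msed_rel_invL)
    have "p dvd q" using N(2) by (rule dvd_mult_left)
    moreover have "q \<in># P \<or> q \<in># Q" using N(1) by (metis union_iff union_single_eq_member)
    ultimately show ?thesis
      unfolding P(3) Q(3) by (meson dvd_mult dvd_prod_mset dvd_trans)
  qed auto
qed

text \<open>The primes of \<open>a\<close> are removed one at a time. A prime \<open>p\<close> of
  \<open>a\<close> divides \<open>b\<close>, and cancelling leaves a' * c = p * b'^2: the second
  \<open>p\<close> comes either from \<open>c\<close>, and then goes into \<open>d\<close>, or again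
  from \<open>a\<close>, and then goes into \<open>m\<close>.\<close>

lemma ufd_conic_parametrization:
  fixes a b c :: "'a::idom"
  assumes ufd: "unique_factorization_domain TYPE('a)" and "a \<noteq> 0" and "a * c = b\<^sup>2"
  shows "\<exists>d m n. a = d * m\<^sup>2 \<and> b = d * m * n \<and> c = d * n\<^sup>2"
proof -
  obtain u P where "u dvd 1" "\<forall>p\<in>#P. irreducible p" "a = u * prod_mset P"
    using ufd_factorization[OF ufd \<open>a \<noteq> 0\<close>] by blast
  then show ?thesis using \<open>a * c = b\<^sup>2\<close>
  proof (induction "size P" arbitrary: P a b c u rule: less_induct)
    case less
    note IH = less.hyps and u = less.prems(1) and P = less.prems(2) and a = less.prems(3)
      and abc = less.prems(4)
    show ?case
    proof (cases "P = {#}")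
      case True
      then obtain v where v: "a * v = 1" using u a by (auto elim: dvdE)
      have "c = v * (a * c)" using v by (metis mult.assoc mult.commute mult_1)
      hence "c = (v * b) * b" by (simp add: abc power2_eq_square ac_simps)
      moreover have "b = a * (v * b)" using v by (metis mult.assoc mult_1)
      ultimately have "a = a * 1\<^sup>2 \<and> b = a * 1 * (v * b) \<and> c = a * (v * b)\<^sup>2"
        by (metis mult.assoc mult.commute mult_1_right one_power2 power2_eq_square)
      then show ?thesis by blast
    next
      case False
      then obtain p Q where PQ: "P = add_mset p Q" by (meson multiset_cases)
      have p: "prime_elem p" "p \<noteq> 0"
        using P PQ ufd ufd_irreducible_imp_prime_elem[OF ufd] by (auto simp: irreducible_def)
      define a' where "a' = u * prod_mset Q"
      have a': "a = p * a'" unfolding a PQ a'_def by (simp add: ac_simps)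
      have "p dvd b" using abc a' p(1)
        by (metis dvd_triv_left mult.assoc prime_elem_dvd_power)
      then obtain b' where b': "b = p * b'" by (elim dvdE)
      have e: "a' * c = p * b'\<^sup>2"
      proof -
        have "p * (a' * c) = p * (p * b'\<^sup>2)"
          using abc unfolding a' b' by (simp add: power2_eq_square ac_simps)
        thus ?thesis using p(2) by simp
      qed
      hence "p dvd a' \<or> p dvd c"
        using p(1) by (metis dvd_triv_left prime_elem_dvd_mult_iff)
      then show ?thesis
      proof
        assume "p dvd c"
        then obtain c' where c': "c = p * c'" by (elim dvdE)
        have "p * (a' * c') = p * b'\<^sup>2" using e c' by (simp add: ac_simps)
        hence "a' * c' = b'\<^sup>2" using p(2) by simp
        then obtain d m n where "a' = d * m\<^sup>2 \<and> b' = d * m * n \<and> c' = d * n\<^sup>2"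
          using IH[of Q u a' c' b'] u P PQ a'_def by auto
        hence "a = (p * d) * m\<^sup>2 \<and> b = (p * d) * m * n \<and> c = (p * d) * n\<^sup>2"
          by (simp add: a' b' c' ac_simps)
        then show ?thesis by blast
      next
        assume "p dvd a'"
        moreover have "\<not> p dvd u"
          using u p(1) by (meson dvd_trans prime_elem_not_unit)
        ultimately have "p dvd prod_mset Q"
          unfolding a'_def using p(1) by (simp add: prime_elem_dvd_mult_iff)
        then obtain q where q: "q \<in># Q" "p dvd q"
          using prime_elem_dvd_prod_mset_idom[OF p(1)] by blast
        obtain R where QR: "Q = add_mset q R" using q(1) by (meson multi_member_split)
        obtain s where s: "q = p * s" using q(2) by (elim dvdE)
        \<comment> \<open>\<open>q\<close> is irreducible and \<open>p\<close> is no unit, so the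
          two are associated; the unit \<open>s\<close> joins \<open>u\<close>.\<close>
        have "irreducible q" using P PQ q(1) by simp
        hence sunit: "s dvd 1" using s p(1) by (metis irreducibleD prime_elem_not_unit)
        define a2 where "a2 = (u * s) * prod_mset R"
        have a2: "a' = p * a2" unfolding a'_def a2_def QR s by (simp add: ac_simps)
        have "p * (a2 * c) = p * b'\<^sup>2" using e a2 by (simp add: ac_simps)
        hence "a2 * c = b'\<^sup>2" using p(2) by simp
        moreover have "u * s dvd 1" using mult_dvd_mono[OF u sunit] by simp
        ultimately obtain d m n where "a2 = d * m\<^sup>2 \<and> b' = d * m * n \<and> c = d * n\<^sup>2"
          using IH[of R "u * s" a2 c b'] P PQ QR a2_def by auto
        hence "a = d * (p * m)\<^sup>2 \<and> b = d * (p * m) * n \<and> c = d * n\<^sup>2"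
          by (simp add: a' b' a2 power2_eq_square ac_simps)
        then show ?thesis by blast
      qed
    qed
  qed
qed

subsection \<open>Determinants of triples\<close>

fun cross_prod :: "'a::comm_ring_1 \<times> 'a \<times> 'a \<Rightarrow> 'a \<times> 'a \<times> 'a \<Rightarrow> 'a \<times> 'a \<times> 'a" where
  "cross_prod (x0, x1, x2) (y0, y1, y2) = (x1 * y2 - x2 * y1, x2 * y0 - x0 * y2, x0 * y1 - x1 * y0)"

fun dot_prod :: "'a::comm_ring_1 \<times> 'a \<times> 'a \<Rightarrow> 'a \<times> 'a \<times> 'a \<Rightarrow> 'a" where
  "dot_prod (x0, x1, x2) (y0, y1, y2) = x0 * y0 + x1 * y1 + x2 * y2"

definition det3 :: "'a::comm_ring_1 \<times> 'a \<times> 'a \<Rightarrow> 'a \<times> 'a \<times> 'a \<Rightarrow> 'a \<times> 'a \<times> 'a \<Rightarrow> 'a" where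
  "det3 x y z = dot_prod (cross_prod x y) z"

lemma dot_cross_self [simp]: "dot_prod (cross_prod x y) x = 0" "dot_prod (cross_prod x y) y = 0"
  by (cases x; cases y; simp add: algebra_simps)+

text \<open>This is the expansion n x (u x v) = (n . v) u - (n . u) v, coordinate by
  coordinate.\<close>

lemma cross_prod_cross_prod_eq_0:
  assumes "dot_prod n u = 0" and "dot_prod n v = 0"
  shows "cross_prod n (cross_prod u v) = (0, 0, 0)"
proof (cases n; cases u; cases v)
  fix n0 n1 n2 u0 u1 u2 v0 v1 v2
  assume e: "n = (n0, n1, n2)" "u = (u0, u1, u2)" "v = (v0, v1, v2)"
  have a: "n0 * u0 + n1 * u1 + n2 * u2 = 0" "n0 * v0 + n1 * v1 + n2 * v2 = 0"
    using assms e by auto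
  have "n1 * (u0 * v1 - u1 * v0) - n2 * (u2 * v0 - u0 * v2)
      = u0 * (n0 * v0 + n1 * v1 + n2 * v2) - v0 * (n0 * u0 + n1 * u1 + n2 * u2)"
    "n2 * (u1 * v2 - u2 * v1) - n0 * (u0 * v1 - u1 * v0)
      = u1 * (n0 * v0 + n1 * v1 + n2 * v2) - v1 * (n0 * u0 + n1 * u1 + n2 * u2)"
    "n0 * (u2 * v0 - u0 * v2) - n1 * (u1 * v2 - u2 * v1)
      = u2 * (n0 * v0 + n1 * v1 + n2 * v2) - v2 * (n0 * u0 + n1 * u1 + n2 * u2)"
    by (simp_all add: algebra_simps)
  note this[unfolded a]
  then show ?thesis unfolding e by simp
qed

text \<open>By proportionality, each coordinate of \<open>m\<close> times
  \<open>dot_prod n z\<close> equals the matching coordinate of \<open>n\<close> times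
  \<open>dot_prod m z\<close>.\<close>

lemma dot_prod_eq_0_parallel:
  fixes n :: "'a::idom \<times> 'a \<times> 'a"
  assumes "cross_prod n m = (0, 0, 0)" and "m \<noteq> (0, 0, 0)" and "dot_prod m z = 0"
  shows "dot_prod n z = 0"
proof (cases n; cases m; cases z)
  fix n0 n1 n2 m0 m1 m2 z0 z1 z2
  assume e: "n = (n0, n1, n2)" "m = (m0, m1, m2)" "z = (z0, z1, z2)"
  have a: "n1 * m2 - n2 * m1 = 0" "n2 * m0 - n0 * m2 = 0" "n0 * m1 - n1 * m0 = 0"
    "m0 * z0 + m1 * z1 + m2 * z2 = 0"
    using assms e by auto
  have "m0 * (n0 * z0 + n1 * z1 + n2 * z2) = 0" "m1 * (n0 * z0 + n1 * z1 + n2 * z2) = 0"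
     "m2 * (n0 * z0 + n1 * z1 + n2 * z2) = 0"
    using a by algebra+
  moreover have "m0 \<noteq> 0 \<or> m1 \<noteq> 0 \<or> m2 \<noteq> 0" using assms(2) e by auto
  ultimately show ?thesis unfolding e by auto
qed

text \<open>A vanishing determinant puts each point in the plane spanned by the two points before
  it. As consecutive points are independent, that plane never changes, and the first normal vector
  stays orthogonal to all points.\<close>

lemma coplanar_sequence:
  fixes y :: "nat \<Rightarrow> 'a::idom \<times> 'a \<times> 'a"
  assumes nz: "\<And>k. cross_prod (y k) (y (Suc k)) \<noteq> (0, 0, 0)"
    and det: "\<And>k. det3 (y k) (y (Suc k)) (y (Suc (Suc k))) = 0"
  shows "dot_prod (cross_prod (y 0) (y 1)) (y k) = 0"
proof -
  define n where "n = cross_prod (y 0) (y 1)"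
  have "dot_prod n (y k) = 0 \<and> dot_prod n (y (Suc k)) = 0"
  proof (induction k)
    case 0
    then show ?case by (simp add: n_def)
  next
    case (Suc k)
    have "cross_prod n (cross_prod (y k) (y (Suc k))) = (0, 0, 0)"
      using Suc by (intro cross_prod_cross_prod_eq_0) auto
    then have "dot_prod n (y (Suc (Suc k))) = 0"
      using dot_prod_eq_0_parallel nz det[unfolded det3_def] by blast
    with Suc show ?case by blast
  qed
  then show ?thesis by (simp add: n_def)
qed

subsection \<open>Approximation by triples\<close>

lemma inverse_golden_ratio:
  "1 / golden_ratio > 1 / 2" "1 / golden_ratio < 1" "(1 / golden_ratio)\<^sup>2 = 1 - 1 / golden_ratio"
proof -
  have s: "sqrt 5 > 2" "sqrt 5 < 3" "sqrt 5 * sqrt 5 = 5"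
    by (simp_all add: real_less_rsqrt real_less_lsqrt)
  have g: "golden_ratio > 1" "golden_ratio < 2"
    using s by (simp_all add: golden_ratio_def)
  have "golden_ratio * golden_ratio = golden_ratio + 1"
    using s by (simp add: golden_ratio_def field_simps)
  then show "(1 / golden_ratio)\<^sup>2 = 1 - 1 / golden_ratio"
    using g by (simp add: field_simps power2_eq_square)
  show "1 / golden_ratio > 1 / 2" "1 / golden_ratio < 1"
    using g by (simp_all add: field_simps)
qed

text \<open>The lower bound 1 makes the infimum positive, so some value lies below twice the infimum
  even when the infimum is not attained.\<close>

lemma exists_near_minimizer:
  fixes f :: "'b \<Rightarrow> real"
  assumes "P x" and "\<And>x. P x \<Longrightarrow> f x \<ge> 1"
  shows "\<exists>y. P y \<and> (\<forall>x. P x \<longrightarrow> f y \<le> 2 * f x)"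
proof -
  define m where "m = Inf (f ` Collect P)"
  have ne: "f ` Collect P \<noteq> {}" and bdd: "bdd_below (f ` Collect P)"
    using assms by (auto intro!: bdd_belowI[of _ 1])
  have "m \<ge> 1" unfolding m_def using ne assms(2) by (intro cInf_greatest) auto
  hence "m < 2 * m" by simp
  then obtain y where "P y" "f y < 2 * m"
    unfolding m_def using cInf_lessD[OF ne] by fastforce
  moreover have "m \<le> f x" if "P x" for x
    unfolding m_def using that bdd by (intro cInf_lower) auto
  ultimately show ?thesis by (intro exI[of _ y]) (auto intro: order_trans[OF less_imp_le])
qed

text \<open>The common setting of both bounds: \<open>j\<close> is the embedding of A into the
  completion, and \<open>discrete\<close> plays the part of the fact that a non-zero integer has
  absolute value at least 1.\<close>

locale discrete_embedding =
  fixes j :: "'a::idom \<Rightarrow> 'c::field" and w :: "'c \<Rightarrow> real"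
  assumes j_add: "j (a + b) = j a + j b"
    and j_mult: "j (a * b) = j a * j b"
    and j_one: "j 1 = 1"
    and abs_w: "absolute_value w"
    and discrete: "a \<noteq> 0 \<Longrightarrow> w (j a) \<ge> 1"
begin

lemma w_nonneg [simp]: "w x \<ge> 0"
  and w_eq_0_iff [simp]: "w x = 0 \<longleftrightarrow> x = 0"
  and w_mult: "w (x * y) = w x * w y"
  and w_add: "w (x + y) \<le> w x + w y"
  using abs_w unfolding absolute_value_def by blast+

lemma w_zero [simp]: "w 0 = 0"
  by simp

lemma w_le_0_iff [simp]: "w x \<le> 0 \<longleftrightarrow> x = 0"
  using w_nonneg[of x] w_eq_0_iff[of x] by linarith

lemma w_one [simp]: "w 1 = 1"
  using w_mult[of 1 1] w_eq_0_iff[of 1] by (metis mult_1 mult_cancel_right1 zero_neq_one)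

lemma w_minus [simp]: "w (- x) = w x"
proof -
  have "(w (- 1))\<^sup>2 = 1" using w_mult[of "-1" "-1"] by (simp add: power2_eq_square)
  hence "w (- 1) = 1" using w_nonneg[of "-1"] by (metis abs_of_nonneg power2_eq_1_iff
        not_one_le_zero le_minus_one_simps(1) le_minus_one_simps(3))
  thus ?thesis using w_mult[of "-1" x] by simp
qed

lemma w_diff: "w (x - y) \<le> w x + w y"
  using w_add[of x "- y"] by simp

lemma w_power: "w (x ^ n) = w x ^ n"
  by (induction n) (simp_all add: w_mult)

lemma w_divide: "w (x / y) = w x / w y"
proof (cases "y = 0")
  case False
  then have "w (x / y) * w y = w x" by (simp add: w_mult[symmetric])
  then show ?thesis using False by (simp add: field_simps)
qed simp

lemma j_zero [simp]: "j 0 = 0"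
  using j_add[of 0 0] by (metis add_cancel_right_right add_0)

lemma j_minus: "j (- a) = - j a"
  using j_add[of a "- a"] by (simp add: eq_neg_iff_add_eq_0 add.commute)

lemma j_diff: "j (a - b) = j a - j b"
  using j_add[of a "- b"] by (simp add: j_minus)

lemma j_power: "j (a ^ n) = j a ^ n"
  by (induction n) (simp_all add: j_mult j_one)

lemmas j_simps = j_add j_diff j_mult j_minus j_one j_power

lemma j_eq_0_iff [simp]: "j a = 0 \<longleftrightarrow> a = 0"
  using discrete[of a] by (cases "a = 0") auto

lemma eq_0_if_small: "w (j a) < 1 \<Longrightarrow> a = 0"
  using discrete[of a] by force

definition height :: "'a \<times> 'a \<times> 'a \<Rightarrow> real" where
  "height x = w (j (fst x))"

definition err :: "'c \<Rightarrow> 'a \<times> 'a \<times> 'a \<Rightarrow> real" where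
  "err \<xi> x = max (w (j (fst x) * \<xi> - j (fst (snd x)))) (w (j (fst x) * \<xi>\<^sup>2 - j (snd (snd x))))"

lemma height_nonneg [simp]: "height x \<ge> 0"
  and err_nonneg [simp]: "err \<xi> x \<ge> 0"
  by (auto simp: height_def err_def le_max_iff_disj)

lemma height_ge_1:
  assumes "x \<noteq> (0, 0, 0)" and "err \<xi> x < 1"
  shows "height x \<ge> 1"
proof (cases x)
  case (fields x0 x1 x2)
  show ?thesis
  proof (cases "x0 = 0")
    case True
    hence "x1 = 0" "x2 = 0"
      using assms(2) fields by (auto simp: err_def intro!: eq_0_if_small)
    with True assms(1) fields show ?thesis by simp
  qed (use fields discrete in \<open>auto simp: height_def\<close>)
qed

text \<open>A 2 x 2 minor changes only in sign when its second column is replaced by the column of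
  errors.\<close>

lemma det2_le: "w (j (x0 * y1 - x1 * y0)) \<le> height (x0, x1, x2) * err \<xi> (y0, y1, y2) + height (y0, y1, y2) * err \<xi> (x0, x1, x2)"
  and det2_le': "w (j (x0 * y2 - x2 * y0)) \<le> height (x0, x1, x2) * err \<xi> (y0, y1, y2) + height (y0, y1, y2) * err \<xi> (x0, x1, x2)"
proof -
  have "j (x0 * y1 - x1 * y0) = j y0 * (j x0 * \<xi> - j x1) - j x0 * (j y0 * \<xi> - j y1)"
    by (simp add: j_simps algebra_simps)
  also have "w \<dots> \<le> w (j y0) * w (j x0 * \<xi> - j x1) + w (j x0) * w (j y0 * \<xi> - j y1)"
    using w_diff by (simp add: w_mult[symmetric])
  also have "\<dots> \<le> height (y0, y1, y2) * err \<xi> (x0, x1, x2) + height (x0, x1, x2) * err \<xi> (y0, y1, y2)"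
    by (intro add_mono mult_mono) (auto simp: height_def err_def)
  finally show "w (j (x0 * y1 - x1 * y0)) \<le> height (x0, x1, x2) * err \<xi> (y0, y1, y2) + height (y0, y1, y2) * err \<xi> (x0, x1, x2)"
    by simp
  have "j (x0 * y2 - x2 * y0) = j y0 * (j x0 * \<xi>\<^sup>2 - j x2) - j x0 * (j y0 * \<xi>\<^sup>2 - j y2)"
    by (simp add: j_simps algebra_simps)
  also have "w \<dots> \<le> w (j y0) * w (j x0 * \<xi>\<^sup>2 - j x2) + w (j x0) * w (j y0 * \<xi>\<^sup>2 - j y2)"
    using w_diff by (simp add: w_mult[symmetric])
  also have "\<dots> \<le> height (y0, y1, y2) * err \<xi> (x0, x1, x2) + height (x0, x1, x2) * err \<xi> (y0, y1, y2)"
    by (intro add_mono mult_mono) (auto simp: height_def err_def)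
  finally show "w (j (x0 * y2 - x2 * y0)) \<le> height (x0, x1, x2) * err \<xi> (y0, y1, y2) + height (y0, y1, y2) * err \<xi> (x0, x1, x2)"
    by simp
qed

text \<open>Subtracting \<xi> and \<xi>^2 times the first column turns the other two columns into
  errors, up to sign. Expansion along the first column then gives three minors of two terms each,
  whence the factor 2.\<close>

lemma det3_le:
  "w (j (det3 x y z)) \<le> 2 * (height x * err \<xi> y * err \<xi> z + height y * err \<xi> x * err \<xi> z
                              + height z * err \<xi> x * err \<xi> y)"
proof (cases x; cases y; cases z)
  fix x0 x1 x2 y0 y1 y2 z0 z1 z2
  assume e: "x = (x0, x1, x2)" "y = (y0, y1, y2)" "z = (z0, z1, z2)"
  define L where "L = (\<lambda>x0 x1. j x0 * \<xi> - j x1)"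
  define M where "M = (\<lambda>x0 x2. j x0 * \<xi>\<^sup>2 - j x2)"
  have L: "w (L x0 x1) \<le> err \<xi> x" "w (L y0 y1) \<le> err \<xi> y" "w (L z0 z1) \<le> err \<xi> z"
    and M: "w (M x0 x2) \<le> err \<xi> x" "w (M y0 y2) \<le> err \<xi> y" "w (M z0 z2) \<le> err \<xi> z"
    by (auto simp: L_def M_def e err_def)
  have m: "w (j a * (p * q - r * s)) \<le> 2 * (height (a, b, c) * P * Q)"
    if "w p \<le> P" "w q \<le> Q" "w r \<le> P" "w s \<le> Q" for a b c p q r s P Q
  proof -
    have "w (p * q - r * s) \<le> w p * w q + w r * w s"
      using w_diff[of "p * q" "r * s"] by (simp add: w_mult)
    also have "\<dots> \<le> P * Q + P * Q"
      using that w_nonneg by (intro add_mono mult_mono) (auto intro: order_trans[OF w_nonneg])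
    finally show ?thesis
      using mult_left_mono[of _ _ "w (j a)"] by (fastforce simp: w_mult height_def)
  qed
  have "j (det3 x y z) = j x0 * (L y0 y1 * M z0 z2 - M y0 y2 * L z0 z1)
    - j y0 * (L x0 x1 * M z0 z2 - M x0 x2 * L z0 z1)
    + j z0 * (L x0 x1 * M y0 y2 - M x0 x2 * L y0 y1)"
    by (simp add: e det3_def L_def M_def j_simps algebra_simps)
  also have "w \<dots> \<le> w (j x0 * (L y0 y1 * M z0 z2 - M y0 y2 * L z0 z1))
    + w (j y0 * (L x0 x1 * M z0 z2 - M x0 x2 * L z0 z1))
    + w (j z0 * (L x0 x1 * M y0 y2 - M x0 x2 * L y0 y1))"
    by (intro order_trans[OF w_add] add_right_mono w_diff)
  also have "\<dots> \<le> 2 * (height x * err \<xi> y * err \<xi> z) + 2 * (height y * err \<xi> x * err \<xi> z)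
                              + 2 * (height z * err \<xi> x * err \<xi> y)"
    unfolding e using L M by (intro add_mono m) (auto simp: e)
  finally show ?thesis by simp
qed

text \<open>The form x0 * x2 - x1^2 vanishes at (1, \<xi>, \<xi>^2), so at an approximating point it
  has the size of height times error and not of height squared.\<close>

lemma conic_le:
  "w (j (x0 * x2 - x1\<^sup>2)) \<le> err \<xi> (x0, x1, x2) * (height (x0, x1, x2) * (1 + 2 * w \<xi>) + err \<xi> (x0, x1, x2))"
proof -
  define E where "E = err \<xi> (x0, x1, x2)"
  define l m where "l = j x0 * \<xi> - j x1" and "m = j x0 * \<xi>\<^sup>2 - j x2"
  have lm: "w l \<le> E" "w m \<le> E" by (auto simp: l_def m_def E_def err_def)
  have two: "w (2 * y) \<le> 2 * w y" for y using w_add[of y y] by simp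
  have "j (x0 * x2 - x1\<^sup>2) = l * (2 * (j x0 * \<xi>) - l) - j x0 * m"
    by (simp add: l_def m_def j_simps algebra_simps power2_eq_square)
  also have "w \<dots> \<le> w l * (2 * (w (j x0) * w \<xi>) + w l) + w (j x0) * w m"
  proof -
    have "w (2 * (j x0 * \<xi>) - l) \<le> 2 * (w (j x0) * w \<xi>) + w l"
      using w_diff[of "2 * (j x0 * \<xi>)" l] two[of "j x0 * \<xi>"] by (simp add: w_mult)
    hence "w l * w (2 * (j x0 * \<xi>) - l) \<le> w l * (2 * (w (j x0) * w \<xi>) + w l)"
      by (intro mult_left_mono) auto
    thus ?thesis using w_diff[of "l * (2 * (j x0 * \<xi>) - l)" "j x0 * m"] by (simp add: w_mult)
  qed
  also have "\<dots> \<le> E * (2 * (w (j x0) * w \<xi>) + E) + w (j x0) * E"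
    using lm order_trans[OF w_nonneg lm(1)] by (intro add_mono mult_mono) auto
  also have "\<dots> = E * (w (j x0) * (1 + 2 * w \<xi>) + E)" by (simp add: algebra_simps)
  finally show ?thesis by (simp add: E_def height_def)
qed

lemma err_pos:
  assumes indep: "\<And>a b c. j a + j b * \<xi> + j c * \<xi>\<^sup>2 = 0 \<Longrightarrow> a = 0 \<and> b = 0 \<and> c = 0"
    and "x \<noteq> (0, 0, 0)"
  shows "err \<xi> x > 0"
proof (cases x)
  case (fields x0 x1 x2)
  have "err \<xi> x \<noteq> 0"
  proof
    assume "err \<xi> x = 0"
    moreover have "w (j x0 * \<xi> - j x1) \<le> err \<xi> x" "w (j x0 * \<xi>\<^sup>2 - j x2) \<le> err \<xi> x"
      by (simp_all add: err_def fields)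
    ultimately have e: "j x0 * \<xi> - j x1 = 0" "j x0 * \<xi>\<^sup>2 - j x2 = 0"
      by (metis w_le_0_iff)+
    have "x0 = 0" using indep[of "- x1" x0 0] e(1) by (simp add: j_minus)
    with e fields assms(2) show False by (simp add: j_minus)
  qed
  thus ?thesis using err_nonneg[of \<xi> x] by linarith
qed

text \<open>Scaling a point multiplies height and error by the same factor; cross-multiplication
  avoids dividing by a height.\<close>

lemma height_err_parallel:
  assumes "cross_prod x y = (0, 0, 0)"
  shows "height x * err \<xi> y = height y * err \<xi> x"
proof (cases x; cases y)
  fix x0 x1 x2 y0 y1 y2
  assume e: "x = (x0, x1, x2)" "y = (y0, y1, y2)"
  have m: "j y2 * j x0 = j y0 * j x2" "j x0 * j y1 = j x1 * j y0"
    using assms e by (simp_all add: j_mult[symmetric] ac_simps)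
  have "j x0 * (j y0 * \<xi> - j y1) = j y0 * (j x0 * \<xi> - j x1)"
    "j x0 * (j y0 * \<xi>\<^sup>2 - j y2) = j y0 * (j x0 * \<xi>\<^sup>2 - j x2)"
    using m by (simp_all add: algebra_simps)
  hence "w (j x0) * w (j y0 * \<xi> - j y1) = w (j y0) * w (j x0 * \<xi> - j x1)"
    "w (j x0) * w (j y0 * \<xi>\<^sup>2 - j y2) = w (j y0) * w (j x0 * \<xi>\<^sup>2 - j x2)"
    by (simp_all only: w_mult[symmetric])
  then show ?thesis
    by (simp add: e height_def err_def max_mult_distrib_left)
qed

text \<open>Replacing the coordinates of \<open>y\<close> by y0 * (1, \<xi>, \<xi>^2) changes a
  linear form only by multiples of the two errors. This links relations satisfied by the points to
  relations satisfied by \<xi>.\<close>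

lemma linear_form_approx:
  "w (j (fst y) * (j n0 + j n1 * \<xi> + j n2 * \<xi>\<^sup>2) - j (dot_prod (n0, n1, n2) y))
    \<le> (w (j n1) + w (j n2)) * err \<xi> y"
proof (cases y)
  case (fields y0 y1 y2)
  have "j (fst y) * (j n0 + j n1 * \<xi> + j n2 * \<xi>\<^sup>2) - j (dot_prod (n0, n1, n2) y)
      = j n1 * (j y0 * \<xi> - j y1) + j n2 * (j y0 * \<xi>\<^sup>2 - j y2)"
    by (simp add: fields j_simps algebra_simps)
  also have "w \<dots> \<le> w (j n1) * w (j y0 * \<xi> - j y1) + w (j n2) * w (j y0 * \<xi>\<^sup>2 - j y2)"
    unfolding w_mult[symmetric] by (rule w_add)
  also have "\<dots> \<le> w (j n1) * err \<xi> y + w (j n2) * err \<xi> y"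
    by (intro add_mono mult_left_mono) (auto simp: fields err_def)
  finally show ?thesis by (simp add: algebra_simps)
qed

text \<open>In a plane with normal \<open>n\<close>, the height of \<open>y k\<close> times the
  value of the form \<open>n\<close> at (1, \<xi>, \<xi>^2) is at most a multiple of the error. The
  error tends to 0 and the height stays at least 1, yet that value is non-zero if \<open>n\<close>
  is.\<close>

lemma not_coplanar_if_err_tendsto_0:
  fixes y :: "nat \<Rightarrow> 'a \<times> 'a \<times> 'a"
  assumes indep: "\<And>a b c. j a + j b * \<xi> + j c * \<xi>\<^sup>2 = 0 \<Longrightarrow> a = 0 \<and> b = 0 \<and> c = 0"
    and nz: "\<And>k. y k \<noteq> (0, 0, 0)" and lim: "(\<lambda>k. err \<xi> (y k)) \<longlonglongrightarrow> 0"
    and n: "\<And>k. dot_prod n (y k) = 0"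
  shows "n = (0, 0, 0)"
proof (rule ccontr)
  assume "n \<noteq> (0, 0, 0)"
  obtain n0 n1 n2 where e: "n = (n0, n1, n2)" by (cases n)
  define \<kappa> where "\<kappa> = w (j n0 + j n1 * \<xi> + j n2 * \<xi>\<^sup>2)"
  have "\<kappa> > 0"
    using indep[of n0 n1 n2] \<open>n \<noteq> (0, 0, 0)\<close> e
    unfolding \<kappa>_def by (auto simp: less_le)
  define D where "D = w (j n1) + w (j n2)"
  have "\<forall>\<^sub>F k in sequentially. \<kappa> \<le> D * err \<xi> (y k)"
  proof -
    have "\<forall>\<^sub>F k in sequentially. err \<xi> (y k) < 1"
      using lim by (rule order_tendstoD) simp
    then show ?thesis
    proof eventually_elim
      case (elim k)
      have "height (y k) * \<kappa> \<le> D * err \<xi> (y k)"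
        using linear_form_approx[of "y k" n0 n1 \<xi> n2] n[of k]
        by (simp add: e D_def \<kappa>_def height_def w_mult)
      moreover have "1 * \<kappa> \<le> height (y k) * \<kappa>"
        using height_ge_1[OF nz elim] \<open>\<kappa> > 0\<close> by (intro mult_right_mono) auto
      ultimately show ?case by simp
    qed
  qed
  moreover have "(\<lambda>k. D * err \<xi> (y k)) \<longlonglongrightarrow> D * 0" by (intro tendsto_intros lim)
  ultimately have "\<kappa> \<le> D * 0" using tendsto_lowerbound trivial_limit_sequentially by blast
  with \<open>\<kappa> > 0\<close> show False by simp
qed

text \<open>Two of the minors are elements of A of absolute value below 1, hence 0; since x0 is
  non-zero, they force the third to vanish.\<close>

lemma cross_prod_eq_0I:
  fixes x y :: "'a \<times> 'a \<times> 'a"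
  assumes "height x * err \<xi> y + height y * err \<xi> x < 1" and "x \<noteq> (0, 0, 0)" and "err \<xi> x < 1"
  shows "cross_prod x y = (0, 0, 0)"
proof (cases x; cases y)
  fix x0 x1 x2 y0 y1 y2
  assume e: "x = (x0, x1, x2)" "y = (y0, y1, y2)"
  have "w (j (x0 * y1 - x1 * y0)) < 1" "w (j (x0 * y2 - x2 * y0)) < 1"
    using det2_le[of x0 y1 x1 y0 x2 \<xi> y2] det2_le'[of x0 y2 x2 y0 x1 \<xi> y1] assms(1)[unfolded e] by linarith+
  hence z: "x0 * y1 = x1 * y0" "x0 * y2 = x2 * y0"
    by (auto dest!: eq_0_if_small)
  have "x0 \<noteq> 0"
    using height_ge_1[OF assms(2,3)] e by (auto simp: height_def)
  have "x0 * (x1 * y2) = x1 * (x0 * y2)" by (simp add: ac_simps)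
  also have "\<dots> = x2 * (x1 * y0)" by (simp add: z ac_simps)
  also have "\<dots> = x0 * (x2 * y1)" by (simp add: z(1)[symmetric] ac_simps)
  finally have "x1 * y2 = x2 * y1" using \<open>x0 \<noteq> 0\<close> by simp
  with z show ?thesis by (simp add: e mult.commute)
qed

text \<open>Substitute for the sequence of minimal points: each new point has, up to a factor 2, the
  least height among the non-zero points with at most a quarter of the previous error. The drop by 4
  has to outweigh the factor 2 lost in near-minimality.\<close>

lemma minimal_chain_exists:
  fixes \<xi> :: 'c
  assumes indep: "\<And>a b c. j a + j b * \<xi> + j c * \<xi>\<^sup>2 = 0 \<Longrightarrow> a = 0 \<and> b = 0 \<and> c = 0"
    and small: "\<And>\<epsilon>. \<epsilon> > 0 \<Longrightarrow> \<exists>x. x \<noteq> (0, 0, 0) \<and> err \<xi> x \<le> \<epsilon>"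
  shows "\<exists>y :: nat \<Rightarrow> 'a \<times> 'a \<times> 'a. \<forall>k. (y k \<noteq> (0, 0, 0) \<and> err \<xi> (y k) < 1) \<and>
           (err \<xi> (y (Suc k)) \<le> err \<xi> (y k) / 4 \<and>
              (\<forall>x. x \<noteq> (0, 0, 0) \<and> err \<xi> x \<le> err \<xi> (y k) / 4 \<longrightarrow> height (y (Suc k)) \<le> 2 * height x))"
proof (rule dependent_nat_choice[where P = "\<lambda>_ y. y \<noteq> (0, 0, 0) \<and> err \<xi> y < 1"
      and Q = "\<lambda>_ y z. err \<xi> z \<le> err \<xi> y / 4 \<and>
        (\<forall>x. x \<noteq> (0, 0, 0) \<and> err \<xi> x \<le> err \<xi> y / 4 \<longrightarrow> height z \<le> 2 * height x)"])
  obtain x where "x \<noteq> (0, 0, 0)" "err \<xi> x \<le> 1 / 2" using small[of "1/2"] by auto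
  then show "\<exists>y. y \<noteq> (0, 0, 0) \<and> err \<xi> y < 1" by (intro exI[of _ x]) simp
next
  fix y :: "'a \<times> 'a \<times> 'a" and k :: nat
  assume y: "y \<noteq> (0, 0, 0) \<and> err \<xi> y < 1"
  define P where "P = (\<lambda>x::'a \<times> 'a \<times> 'a. x \<noteq> (0, 0, 0) \<and> err \<xi> x \<le> err \<xi> y / 4)"
  have "err \<xi> y > 0" using y by (intro err_pos indep) auto
  then obtain x where "P x" using small[of "err \<xi> y / 4"] by (auto simp: P_def)
  moreover have "height x \<ge> 1" if "P x" for x
    using that y by (intro height_ge_1[of x \<xi>]) (auto simp: P_def)
  ultimately obtain z where z: "P z" "\<forall>x. P x \<longrightarrow> height z \<le> 2 * height x"
    using exists_near_minimizer[of P x height] by blast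
  moreover have "err \<xi> z < 1" using z(1) y \<open>err \<xi> y > 0\<close> by (simp add: P_def)
  ultimately show "\<exists>z. (z \<noteq> (0, 0, 0) \<and> err \<xi> z < 1) \<and> err \<xi> z \<le> err \<xi> y / 4 \<and>
      (\<forall>x. x \<noteq> (0, 0, 0) \<and> err \<xi> x \<le> err \<xi> y / 4 \<longrightarrow> height z \<le> 2 * height x)"
    unfolding P_def by blast
qed

subsection \<open>The upper bound\<close>

text \<open>The point on the conic is d * (m^2, m * n, n^2), so \<xi> is approximated by n / m with
  |m| at most the square root of the height. Comparing \<open>x\<close> with (m, n) rather than with
  the whole point makes x0 * n - x1 * m and x1 * n - x2 * m smaller than 1, hence 0.\<close>

lemma parallel_if_on_conic:
  fixes x :: "'a \<times> 'a \<times> 'a"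
  assumes ufd: "unique_factorization_domain TYPE('a)"
    and y: "y0 \<noteq> 0" "y0 * y2 = y1\<^sup>2" "err \<xi> (y0, y1, y2) \<le> 1"
    and h: "height x \<le> 2 * height (y0, y1, y2)" and e: "err \<xi> (y0, y1, y2) \<le> err \<xi> x"
    and small: "3 * (1 + w \<xi>) * sqrt (height (y0, y1, y2)) * err \<xi> x < 1"
  shows "cross_prod x (y0, y1, y2) = (0, 0, 0)"
proof -
  obtain x0 x1 x2 where x: "x = (x0, x1, x2)" by (cases x)
  define Y Lx Ly where "Y = height (y0, y1, y2)" and "Lx = err \<xi> x" and "Ly = err \<xi> (y0, y1, y2)"
  obtain d m n where dmn: "y0 = d * m\<^sup>2" "y1 = d * m * n" "y2 = d * n\<^sup>2"
    using ufd_conic_parametrization[OF ufd y(1,2)] by blast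
  have nz: "d \<noteq> 0" "m \<noteq> 0" using y(1) dmn by auto
  define \<delta> \<mu> where "\<delta> = w (j d)" and "\<mu> = w (j m)"
  have dm: "\<delta> \<ge> 1" "\<mu> \<ge> 1" using nz discrete by (auto simp: \<delta>_def \<mu>_def)
  have Y: "Y = \<delta> * \<mu>\<^sup>2" by (simp add: Y_def height_def dmn j_simps w_mult w_power \<delta>_def \<mu>_def)
  have "\<mu>\<^sup>2 \<le> Y" unfolding Y using dm by (simp add: mult_le_cancel_right1)
  hence \<mu>_le: "\<mu> \<le> sqrt Y" by (simp add: real_le_rsqrt)
  have "Y \<ge> 1" using \<open>\<mu>\<^sup>2 \<le> Y\<close> one_le_power[OF dm(2), of 2] by linarith
  have L: "0 \<le> Lx" "0 \<le> Ly" "Ly \<le> Lx" "Ly \<le> 1" using e y by (simp_all add: Lx_def Ly_def)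
  \<comment> \<open>The factor d * m contained in y0 * \<xi> - y1 keeps \<open>\<eta>\<close> small
    even after multiplication by the full height \<open>Y\<close>.\<close>
  define \<eta> where "\<eta> = w (j m * \<xi> - j n)"
  have "\<delta> * \<mu> * \<eta> = w (j y0 * \<xi> - j y1)"
    unfolding \<delta>_def \<mu>_def \<eta>_def w_mult[symmetric]
    by (simp add: dmn j_simps algebra_simps power2_eq_square)
  also have "\<dots> \<le> Ly" by (simp add: Ly_def err_def)
  finally have "\<mu> * (\<delta> * \<mu> * \<eta>) \<le> \<mu> * Ly" using dm by (intro mult_left_mono) auto
  hence Y\<eta>: "Y * \<eta> \<le> \<mu> * Ly" unfolding Y by (simp add: power2_eq_square ac_simps)
  have "1 * \<eta> \<le> Y * \<eta>" using \<open>Y \<ge> 1\<close> by (intro mult_right_mono) (auto simp: \<eta>_def)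
  hence \<eta>: "\<eta> \<le> \<mu> * Ly" using Y\<eta> by simp
  have \<mu>L: "\<mu> * Ly \<le> \<mu> * Lx" using L dm by simp
  define s where "s = w \<xi>"
  have "s \<ge> 0" by (simp add: s_def)
  have lt: "3 * (1 + s) * (\<mu> * Lx) < 1"
  proof -
    have "\<mu> * Lx \<le> sqrt Y * Lx" using \<mu>_le L by (intro mult_right_mono)
    hence "3 * (1 + s) * (\<mu> * Lx) \<le> 3 * (1 + s) * (sqrt Y * Lx)"
      using \<open>s \<ge> 0\<close> by (intro mult_left_mono) auto
    also have "\<dots> < 1" using small by (simp add: Y_def Lx_def s_def ac_simps)
    finally show ?thesis .
  qed
  have ex: "w (j x0) \<le> 2 * Y" "w (j x0 * \<xi> - j x1) \<le> Lx" "w (j x0 * \<xi>\<^sup>2 - j x2) \<le> Lx"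
    using h by (auto simp: x Lx_def Y_def err_def height_def)
  have x0\<eta>: "w (j x0) * \<eta> \<le> 2 * (\<mu> * Lx)"
  proof -
    have "w (j x0) * \<eta> \<le> (2 * Y) * \<eta>" using ex by (intro mult_right_mono) (auto simp: \<eta>_def)
    thus ?thesis using Y\<eta> \<mu>L by simp
  qed
  have e01: "w (j (x0 * n - x1 * m)) < 1"
  proof -
    have "j (x0 * n - x1 * m) = j m * (j x0 * \<xi> - j x1) - j x0 * (j m * \<xi> - j n)"
      by (simp add: j_simps algebra_simps)
    also have "w \<dots> \<le> \<mu> * w (j x0 * \<xi> - j x1) + w (j x0) * \<eta>"
      unfolding \<mu>_def \<eta>_def w_mult[symmetric] by (rule w_diff)
    also have "\<dots> \<le> \<mu> * Lx + 2 * (\<mu> * Lx)"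
      using ex(2) x0\<eta> dm by (intro add_mono mult_left_mono) auto
    also have "\<dots> \<le> 3 * (1 + s) * (\<mu> * Lx)"
      using \<open>s \<ge> 0\<close> L dm by (simp add: algebra_simps)
    finally show ?thesis using lt by linarith
  qed
  have e12: "w (j (x1 * n - x2 * m)) < 1"
  proof -
    have "j (x1 * n - x2 * m) = (j m * (j x0 * \<xi>\<^sup>2 - j x2) - j m * (\<xi> * (j x0 * \<xi> - j x1)))
        - (\<xi> * (j x0 * (j m * \<xi> - j n)) - (j x0 * \<xi> - j x1) * (j m * \<xi> - j n))"
      by (simp add: j_simps algebra_simps power2_eq_square)
    also have "w \<dots> \<le> (\<mu> * w (j x0 * \<xi>\<^sup>2 - j x2) + \<mu> * (s * w (j x0 * \<xi> - j x1)))
        + (s * (w (j x0) * \<eta>) + w (j x0 * \<xi> - j x1) * \<eta>)"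
      unfolding \<mu>_def \<eta>_def s_def w_mult[symmetric]
      by (intro order_trans[OF w_diff] add_mono w_diff)
    also have "\<dots> \<le> (\<mu> * Lx + \<mu> * (s * Lx)) + (s * (2 * (\<mu> * Lx)) + Lx * (\<mu> * Ly))"
    proof -
      have "w (j x0 * \<xi> - j x1) * \<eta> \<le> Lx * (\<mu> * Ly)"
        using ex(2) \<eta> L by (intro mult_mono) (auto simp: \<eta>_def)
      moreover have "s * (w (j x0) * \<eta>) \<le> s * (2 * (\<mu> * Lx))"
        using x0\<eta> \<open>s \<ge> 0\<close> by (rule mult_left_mono)
      moreover have "\<mu> * (s * w (j x0 * \<xi> - j x1)) \<le> \<mu> * (s * Lx)"
        using ex(2) \<open>s \<ge> 0\<close> dm by (intro mult_left_mono) auto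
      moreover have "\<mu> * w (j x0 * \<xi>\<^sup>2 - j x2) \<le> \<mu> * Lx"
        using ex(3) dm by (intro mult_left_mono) auto
      ultimately show ?thesis by linarith
    qed
    also have "(\<mu> * Lx + \<mu> * (s * Lx)) + (s * (2 * (\<mu> * Lx)) + Lx * (\<mu> * Ly)) \<le> 3 * (1 + s) * (\<mu> * Lx)"
    proof -
      have "Lx * (\<mu> * Ly) \<le> Lx * (\<mu> * 1)"
        using L dm by (intro mult_left_mono) auto
      moreover have "Lx * (\<mu> * 1) \<le> 2 * (\<mu> * Lx)" using L dm by simp
      moreover have "3 * (1 + s) * (\<mu> * Lx)
          = (\<mu> * Lx + \<mu> * (s * Lx)) + s * (2 * (\<mu> * Lx)) + 2 * (\<mu> * Lx)"
        by (simp add: algebra_simps)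
      ultimately show ?thesis by linarith
    qed
    finally show ?thesis using lt by linarith
  qed
  have z: "x0 * n = x1 * m" "x1 * n = x2 * m"
    using eq_0_if_small[OF e01] eq_0_if_small[OF e12] by simp_all
  have "x1 * y2 - x2 * y1 = d * n * (x1 * n - x2 * m)"
    "x2 * y0 - x0 * y2 = d * m * (x2 * m - x1 * n) + d * n * (x1 * m - x0 * n)"
    "x0 * y1 - x1 * y0 = d * m * (x0 * n - x1 * m)"
    by (simp_all add: dmn power2_eq_square algebra_simps)
  then show ?thesis by (simp add: x z)
qed

theorem uniform_exponent_le_inverse_golden_ratio:
  assumes ufd: "unique_factorization_domain TYPE('a)"
    and indep: "\<And>a b c. j a + j b * \<xi> + j c * \<xi>\<^sup>2 = 0 \<Longrightarrow> a = 0 \<and> b = 0 \<and> c = 0"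
  shows "\<exists>c>0. \<forall>B. \<exists>X>0. X \<ge> B \<and>
    \<not> (\<exists>x. x \<noteq> (0, 0, 0) \<and> height x \<le> X \<and> err \<xi> x \<le> c * X powr (- 1 / golden_ratio))"
proof (rule ccontr)
  assume neg: "\<not> ?thesis"
  define \<sigma> s where "\<sigma> = 1 / golden_ratio" and "s = w \<xi>"
  have \<sigma>: "\<sigma> > 1 / 2" "\<sigma> < 1" "\<sigma>\<^sup>2 = 1 - \<sigma>"
    unfolding \<sigma>_def by (rule inverse_golden_ratio)+
  have "s \<ge> 0" by (simp add: s_def)
  \<comment> \<open>This size serves three estimates: 48 * c * (1 + s) < 1 when the conic lemma is
    applied, 32 * c * (1 + s) \<le> 1 in the bound drawn from the conic form, and 2560 * c^2 < 1 in
    the final contradiction.\<close>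
  define c where "c = 1 / (128 * (1 + s))"
  have c: "c > 0" "c \<le> 1" "c * (1 + s) = 1 / 128"
    using \<open>s \<ge> 0\<close> by (simp_all add: c_def field_simps)
  define S where "S = (\<lambda>X. \<exists>x. x \<noteq> (0, 0, 0) \<and> height x \<le> X \<and> err \<xi> x \<le> c * X powr (- 1 / golden_ratio))"
  have "\<not> (\<forall>B. \<exists>X>0. X \<ge> B \<and> \<not> S X)"
    using neg c(1) unfolding S_def by meson
  then obtain B0 where B0: "\<And>X. X > 0 \<Longrightarrow> X \<ge> B0 \<Longrightarrow> S X" by blast
  define B where "B = max 1 B0"
  have "B \<ge> 1" by (simp add: B_def)
  have sol: "\<exists>x. x \<noteq> (0, 0, 0) \<and> height x \<le> X \<and> err \<xi> x \<le> c * X powr (- \<sigma>)" if "X \<ge> B" for X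
    using B0[of X] that unfolding S_def \<sigma>_def B_def minus_divide_left by simp
  have small: "\<exists>x. x \<noteq> (0, 0, 0) \<and> err \<xi> x \<le> \<epsilon>" if "\<epsilon> > 0" for \<epsilon>
  proof -
    define X where "X = max B ((1 / \<epsilon>) powr (1 / \<sigma>))"
    have "X powr (- \<sigma>) \<le> ((1 / \<epsilon>) powr (1 / \<sigma>)) powr (- \<sigma>)"
      using \<sigma> that by (intro powr_mono2') (auto simp: X_def)
    also have "\<dots> = \<epsilon>"
      using \<sigma> that by (simp add: powr_powr powr_minus_divide)
    finally have "X powr (- \<sigma>) \<le> \<epsilon>" .
    moreover have "c * X powr (- \<sigma>) \<le> 1 * X powr (- \<sigma>)"
      using c by (intro mult_right_mono) auto
    moreover obtain x where "x \<noteq> (0, 0, 0)" "err \<xi> x \<le> c * X powr (- \<sigma>)"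
      using sol[of X] unfolding X_def by auto
    ultimately show ?thesis by (intro exI[of _ x]) linarith
  qed
  have "\<exists>y :: nat \<Rightarrow> 'a \<times> 'a \<times> 'a. \<forall>k. (y k \<noteq> (0, 0, 0) \<and> err \<xi> (y k) < 1) \<and>
           (err \<xi> (y (Suc k)) \<le> err \<xi> (y k) / 4 \<and>
              (\<forall>x. x \<noteq> (0, 0, 0) \<and> err \<xi> x \<le> err \<xi> (y k) / 4 \<longrightarrow> height (y (Suc k)) \<le> 2 * height x))"
    using indep small by (rule minimal_chain_exists)
  then obtain y :: "nat \<Rightarrow> 'a \<times> 'a \<times> 'a" where
    y: "\<And>k. y k \<noteq> (0, 0, 0)" "\<And>k. err \<xi> (y k) < 1"
      and Lstep: "\<And>k. err \<xi> (y (Suc k)) \<le> err \<xi> (y k) / 4"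
      and Hmin: "\<And>k x. x \<noteq> (0, 0, 0) \<Longrightarrow> err \<xi> x \<le> err \<xi> (y k) / 4 \<Longrightarrow> height (y (Suc k)) \<le> 2 * height x"
    by blast
  define L H where "L = (\<lambda>k. err \<xi> (y k))" and "H = (\<lambda>k. height (y k))"
  have Lpos: "L k > 0" for k unfolding L_def using indep y(1) by (rule err_pos)
  have H1: "H k \<ge> 1" for k unfolding H_def using y by (rule height_ge_1)
  have Lstep: "L (Suc k) \<le> L k / 4" for k unfolding L_def by (rule Lstep)
  have Ldec: "L k \<le> L i" if "i \<le> k" for i k
  proof (rule lift_Suc_antimono_le[OF _ that])
    show "L (Suc n) \<le> L n" for n using Lstep[of n] Lpos[of n] by linarith
  qed
  have Lpow: "L k \<le> (1 / 4) ^ k" for k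
  proof (induction k)
    case 0
    then show ?case using y(2)[of 0] by (simp add: L_def)
  next
    case (Suc k)
    then show ?case using Lstep[of k] by simp
  qed
  have Llim: "L \<longlonglongrightarrow> 0"
  proof (rule tendsto_sandwich)
    show "\<forall>\<^sub>F k in sequentially. 0 \<le> L k" "\<forall>\<^sub>F k in sequentially. L k \<le> (1 / 4) ^ k"
      using Lpow Lpos by (auto intro!: always_eventually less_imp_le)
    show "(\<lambda>k. 0 :: real) \<longlonglongrightarrow> 0" by simp
    show "(\<lambda>k. (1 / 4 :: real) ^ k) \<longlonglongrightarrow> 0" by (intro LIMSEQ_power_zero) simp
  qed
  \<comment> \<open>\<open>y k\<close> is itself a candidate for the place \<open>i\<close>, its
    error being at most a quarter of that of the point before \<open>y i\<close>. The point
    \<open>y 0\<close> was not chosen by near-minimality, hence 1 \<le> i.\<close>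
  have Hmono: "H i \<le> 2 * H k" if "1 \<le> i" "i \<le> k" for i k
  proof -
    obtain i' where i': "i = Suc i'" using \<open>1 \<le> i\<close> by (cases i) auto
    have "L k \<le> L i' / 4" using Ldec[OF \<open>i \<le> k\<close>] Lstep[of i'] by (simp add: i')
    then show ?thesis using Hmin[of "y k" i'] y by (simp add: H_def L_def i')
  qed
  \<comment> \<open>A solution for X = H (Suc k) / 4 is too low to be a candidate for
    \<open>y (Suc k)\<close>, so its error exceeds a quarter of \<open>L k\<close>. The constant 16
    is 4 times the bound 4 for 4 powr \<sigma>.\<close>
  have LH: "L k \<le> 16 * c * H (Suc k) powr (- \<sigma>)" if "H (Suc k) \<ge> 4 * B" for k
  proof -
    have "H (Suc k) / 4 \<ge> B" using that by simp
    from sol[OF this] obtain x where x: "x \<noteq> (0, 0, 0)" "height x \<le> H (Suc k) / 4"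
        "err \<xi> x \<le> c * (H (Suc k) / 4) powr (- \<sigma>)"
      by blast
    have "\<not> err \<xi> x \<le> L k / 4"
      using Hmin[OF x(1), of k] x(2) H1[of "Suc k"] by (auto simp: L_def H_def)
    hence "L k \<le> 4 * (c * (H (Suc k) / 4) powr (- \<sigma>))" using x(3) by linarith
    also have "(H (Suc k) / 4) powr (- \<sigma>) = 4 powr \<sigma> * H (Suc k) powr (- \<sigma>)"
      using H1[of "Suc k"] by (simp add: powr_divide powr_minus_divide)
    also have "4 * (c * (4 powr \<sigma> * H (Suc k) powr (- \<sigma>))) \<le> 4 * (c * (4 powr 1 * H (Suc k) powr (- \<sigma>)))"
      using c \<sigma> by (intro mult_left_mono mult_right_mono powr_mono) auto
    finally show ?thesis by simp
  qed
  \<comment> \<open>For proportional points the error can drop by a factor 4 only if the height does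
    too, whereas \<open>Hmono\<close> allows a drop by at most 2.\<close>
  have ncross: "cross_prod (y k) (y (Suc k)) \<noteq> (0, 0, 0)" if "k \<ge> 1" for k
  proof
    assume "cross_prod (y k) (y (Suc k)) = (0, 0, 0)"
    hence "H (Suc k) * L k = H k * L (Suc k)"
      using height_err_parallel[of "y k" "y (Suc k)" \<xi>] by (simp add: H_def L_def)
    also have "\<dots> \<le> H k * (L k / 4)" using Lstep H1[of k] by (intro mult_left_mono) auto
    finally have "H (Suc k) * L k \<le> (H k / 4) * L k" by simp
    hence "H (Suc k) \<le> H k / 4" using Lpos[of k] by (simp only: mult_le_cancel_right_pos)
    with Hmono[of k "Suc k"] H1[of k] that show False by linarith
  qed
  \<comment> \<open>Bounded heights with errors tending to 0 would make the minors of consecutive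
    points smaller than 1. The bound 8 * B leaves 4 * B for all later heights after the factor 2 of
    \<open>Hmono\<close>, as \<open>LH\<close> requires.\<close>
  have "\<exists>K\<ge>1. H K \<ge> 8 * B"
  proof (rule ccontr)
    assume bounded: "\<not> ?thesis"
    have lt: "H k < 8 * B" if "k \<ge> 1" for k using bounded that by (meson not_le)
    have "\<forall>\<^sub>F k in sequentially. L k < 1 / (16 * B)"
      using Llim \<open>B \<ge> 1\<close> by (intro order_tendstoD(2)) auto
    then obtain k where k: "k \<ge> 1" "L k < 1 / (16 * B)"
      unfolding eventually_sequentially by (metis nat_le_linear)
    have "H k * L (Suc k) + H (Suc k) * L k \<le> 8 * B * L k + 8 * B * L k"
      using lt[of k] lt[of "Suc k"] k(1) Ldec[of k "Suc k"] Lpos[of k] Lpos[of "Suc k"] H1[of k] H1[of "Suc k"]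
      by (intro add_mono mult_mono) auto
    also have "\<dots> < 1" using k(2) \<open>B \<ge> 1\<close> by (simp add: field_simps)
    finally have "cross_prod (y k) (y (Suc k)) = (0, 0, 0)"
      using y by (intro cross_prod_eq_0I[of _ \<xi>]) (auto simp: H_def L_def)
    with ncross[OF k(1)] show False by blast
  qed
  then obtain K where K: "K \<ge> 1" "H K \<ge> 8 * B" by blast
  have Hge: "H k \<ge> 4 * B" if "k \<ge> K" for k
    using Hmono[of K k] K that by linarith
  \<comment> \<open>Otherwise all points from \<open>K\<close> on lie in one plane, which the
    independence of 1, \<xi> and \<xi>^2 forbids.\<close>
  have "\<exists>k\<ge>K. det3 (y k) (y (Suc k)) (y (Suc (Suc k))) \<noteq> 0"
  proof (rule ccontr)
    assume "\<not> ?thesis"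
    hence "dot_prod (cross_prod (y (K + 0)) (y (K + 1))) (y (K + k)) = 0" for k
      using coplanar_sequence[of "\<lambda>k. y (K + k)"] ncross K(1) by auto
    moreover have "(\<lambda>k. err \<xi> (y (K + k))) \<longlonglongrightarrow> 0"
      using LIMSEQ_ignore_initial_segment[OF Llim, of K] by (simp add: L_def add.commute)
    ultimately have "cross_prod (y (K + 0)) (y (K + 1)) = (0, 0, 0)"
      using y(1) by (intro not_coplanar_if_err_tendsto_0[of \<xi> "\<lambda>k. y (K + k)", OF indep]) auto
    with ncross[of K] K(1) show False by simp
  qed
  then obtain k where k: "k \<ge> K" and det: "det3 (y k) (y (Suc k)) (y (Suc (Suc k))) \<noteq> 0" by blast
  define Y Z where "Y = H (Suc k)" and "Z = H (Suc (Suc k))"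
  have YZ: "Y \<ge> 1" "Z \<ge> 1" using H1 by (simp_all add: Y_def Z_def)
  have Lx: "L k \<le> 16 * c * Y powr (- \<sigma>)" and Ly: "L (Suc k) \<le> 16 * c * Z powr (- \<sigma>)"
    unfolding Y_def Z_def using k by (auto intro!: LH Hge)
  have Hx: "H k \<le> 2 * Y" "H k \<le> 2 * Z" "Y \<le> 2 * Z"
    unfolding Y_def Z_def using k K by (auto intro!: Hmono)
  \<comment> \<open>The three terms of the determinant bound are at most 2, 2 and 1 times Z * L k *
    L (Suc k), and their sum is doubled.\<close>
  have "1 \<le> 10 * (Z * L k * L (Suc k))"
  proof -
    have "1 \<le> 2 * (H k * L (Suc k) * L (Suc (Suc k)) + Y * L k * L (Suc (Suc k)) + Z * L k * L (Suc k))"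
      using discrete[OF det] det3_le[of "y k" "y (Suc k)" "y (Suc (Suc k))" \<xi>]
      by (simp add: H_def L_def Y_def Z_def)
    also have "\<dots> \<le> 2 * (2 * Z * L (Suc k) * L k + 2 * Z * L k * L (Suc k) + Z * L k * L (Suc k))"
      using Hx YZ Ldec[of k "Suc (Suc k)"] Ldec[of "Suc k" "Suc (Suc k)"] Lpos[THEN less_imp_le]
      by (intro mult_left_mono add_mono mult_mono) auto
    finally show ?thesis by (simp add: ac_simps)
  qed
  also have "\<dots> \<le> 10 * (Z * (16 * c * Y powr (- \<sigma>)) * (16 * c * Z powr (- \<sigma>)))"
    using Lx Ly YZ c Lpos[THEN less_imp_le] by (intro mult_left_mono mult_mono) auto
  also have "\<dots> = 2560 * c\<^sup>2 * Y powr (- \<sigma>) * Z powr (1 - \<sigma>)"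
    using YZ by (simp add: powr_diff powr_minus_divide power2_eq_square)
  finally have upper: "1 \<le> 2560 * c\<^sup>2 * Y powr (- \<sigma>) * Z powr (1 - \<sigma>)" .
  obtain y0 y1 y2 where yk: "y (Suc k) = (y0, y1, y2)" by (cases "y (Suc k)")
  have conic: "y0 * y2 - y1\<^sup>2 \<noteq> 0"
  proof
    assume con: "y0 * y2 - y1\<^sup>2 = 0"
    have "cross_prod (y k) (y0, y1, y2) = (0, 0, 0)"
    proof (rule parallel_if_on_conic[OF ufd])
      show "y0 \<noteq> 0" using H1[of "Suc k"] by (auto simp: H_def yk height_def)
      show "y0 * y2 = y1\<^sup>2" using con by simp
      show "err \<xi> (y0, y1, y2) \<le> 1" using y(2)[of "Suc k"] by (simp add: yk)
      show "height (y k) \<le> 2 * height (y0, y1, y2)" using Hx(1) by (simp add: Y_def H_def yk)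
      show "err \<xi> (y0, y1, y2) \<le> err \<xi> (y k)" using Ldec[of k "Suc k"] by (simp add: L_def yk)
      \<comment> \<open>Since \<sigma> > 1/2, \<open>L k\<close> is at most 16 * c over the square
        root of \<open>Y\<close>, the smallness that the conic lemma asks for.\<close>
      have "sqrt Y * L k \<le> Y powr (1/2) * (16 * c * Y powr (- (1/2)))"
      proof (intro mult_mono order_trans[OF Lx] mult_left_mono)
        show "Y powr (- \<sigma>) \<le> Y powr (- (1/2))" using \<sigma> YZ by (intro powr_mono) auto
      qed (use YZ c Lpos[of k] in \<open>auto simp: powr_half_sqrt\<close>)
      also have "\<dots> = 16 * c" using YZ by (simp add: powr_minus_divide)
      finally have "3 * (1 + s) * (sqrt Y * L k) \<le> 3 * (1 + s) * (16 * c)"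
        using \<open>s \<ge> 0\<close> by (intro mult_left_mono) auto
      also have "\<dots> = 48 * (c * (1 + s))" by simp
      also have "\<dots> < 1" unfolding c(3) by simp
      finally show "3 * (1 + w \<xi>) * sqrt (height (y0, y1, y2)) * err \<xi> (y k) < 1"
        by (simp add: s_def Y_def H_def L_def yk mult.assoc)
    qed
    with ncross[of k] k K show False by (simp add: yk)
  qed
  \<comment> \<open>The conic form at \<open>y (Suc k)\<close> is a non-zero element of A. In the
    second factor L (Suc k) is replaced by \<open>Y\<close>, as L (Suc k) < 1 \<le> Y; the outcome
    is Z powr \<sigma> \<le> Y.\<close>
  have "1 \<le> L (Suc k) * (Y * (1 + 2 * s) + L (Suc k))"
    using discrete[OF conic] conic_le[of y0 y2 y1 \<xi>] by (simp add: L_def Y_def H_def s_def yk)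
  also have "\<dots> \<le> (16 * c * Z powr (- \<sigma>)) * (Y * (1 + 2 * s) + Y)"
    using Ly YZ y(2)[of "Suc k"] Lpos[of "Suc k"] \<open>s \<ge> 0\<close> by (intro mult_mono add_mono) (auto simp: L_def)
  also have "\<dots> = 32 * (c * (1 + s)) * (Y * Z powr (- \<sigma>))" by (simp add: algebra_simps)
  also have "\<dots> \<le> Y * Z powr (- \<sigma>)" using c(3) YZ by simp
  finally have "Z powr \<sigma> \<le> Y" using YZ by (simp add: powr_minus_divide field_simps)
  \<comment> \<open>By \<sigma>^2 = 1 - \<sigma>, raising to the power \<sigma> yields exactly the
    powers in \<open>upper\<close>; they cancel and leave 1 \<le> 2560 * c^2.\<close>
  hence "(Z powr \<sigma>) powr \<sigma> \<le> Y powr \<sigma>" using \<sigma> by (intro powr_mono2) auto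
  hence "Z powr (1 - \<sigma>) \<le> Y powr \<sigma>"
    using \<sigma>(3) by (simp add: powr_powr power2_eq_square)
  hence "2560 * c\<^sup>2 * Y powr (- \<sigma>) * Z powr (1 - \<sigma>) \<le> 2560 * c\<^sup>2 * Y powr (- \<sigma>) * Y powr \<sigma>"
    by (intro mult_left_mono) auto
  also have "\<dots> = 2560 * c\<^sup>2" using YZ by (simp add: powr_minus_divide)
  also have "c \<le> 1 / 128" using \<open>s \<ge> 0\<close> by (simp add: c_def field_simps)
  hence "2560 * c\<^sup>2 \<le> 2560 * (1 / 128)\<^sup>2" using c by (intro mult_left_mono power_mono) auto
  finally show False using upper by (simp add: power2_eq_square)
qed

end

subsection \<open>The extremal construction\<close>

type_synonym 'a mat2 = "'a \<times> 'a \<times> 'a \<times> 'a"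

fun mmul :: "'a::comm_ring_1 mat2 \<Rightarrow> 'a mat2 \<Rightarrow> 'a mat2" where
  "mmul (p, q, r, s) (p', q', r', s') = (p * p' + q * r', p * q' + q * s', r * p' + s * r', r * q' + s * s')"

fun mdet :: "'a::comm_ring_1 mat2 \<Rightarrow> 'a" where
  "mdet (p, q, r, s) = p * s - q * r"

fun mtranspose :: "'a mat2 \<Rightarrow> 'a mat2" where
  "mtranspose (p, q, r, s) = (p, r, q, s)"

lemma mmul_assoc: "mmul (mmul x y) z = mmul x (mmul y z)"
  by (cases x; cases y; cases z) (simp add: algebra_simps)

lemma mtranspose_mmul: "mtranspose (mmul x y) = mmul (mtranspose y) (mtranspose x)"
  by (cases x; cases y) (simp add: algebra_simps)

lemma mdet_mmul: "mdet (mmul x y) = mdet x * mdet y"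
  by (cases x; cases y) (simp add: algebra_simps)

definition cf_mat :: "'a::comm_ring_1 \<Rightarrow> 'a mat2" where
  "cf_mat a = (a, 1, 1, 0)"

text \<open>The two orders give transposes of each other, as \<open>cf_mat\<close> is symmetric; for
  a \<noteq> b neither product is symmetric.\<close>

definition twist :: "'a::comm_ring_1 \<Rightarrow> 'a \<Rightarrow> nat \<Rightarrow> 'a mat2" where
  "twist a b k = (if even k then mmul (cf_mat b) (cf_mat a) else mmul (cf_mat a) (cf_mat b))"

text \<open>The matrices are products of \<open>cf_mat\<close> along palindromic prefixes of the
  Fibonacci word: empty, a, aba, abaaba, abaababaaba, and so on. They belong to the continued
  fraction with partial quotients a, b, a, a, b, ...\<close>

fun roy_mat :: "'a::comm_ring_1 \<Rightarrow> 'a \<Rightarrow> nat \<Rightarrow> 'a mat2" where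
  "roy_mat a b 0 = (1, 0, 0, 1)"
| "roy_mat a b (Suc 0) = cf_mat a"
| "roy_mat a b (Suc (Suc k)) = mmul (mmul (roy_mat a b (Suc k)) (twist a b k)) (roy_mat a b k)"

lemma mtranspose_twist: "mtranspose (twist a b k) = twist a b (Suc k)"
  by (simp add: twist_def mtranspose_mmul) (simp add: cf_mat_def)

text \<open>Unfolding the recursion twice gives y T x T' y with T' the transpose of T, which is
  symmetric whenever x and y are. The case k = 2 is the product along the palindrome aba.\<close>

lemma mtranspose_roy_mat: "mtranspose (roy_mat a b k) = roy_mat a b k"
proof (induction k rule: less_induct)
  case (less k)
  consider "k = 0" | "k = 1" | "k = 2" | i where "k = Suc (Suc (Suc i))"
    by (metis One_nat_def Suc_1 not0_implies_Suc)
  then show ?case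
  proof cases
    case 3
    then show ?thesis by (simp add: numeral_2_eq_2 twist_def cf_mat_def algebra_simps)
  next
    case (4 i)
    define x y T where "x = roy_mat a b i" and "y = roy_mat a b (Suc i)" and "T = twist a b i"
    define T' where "T' = twist a b (Suc i)"
    have sym: "mtranspose x = x" "mtranspose y = y"
      using less.IH[of i] less.IH[of "Suc i"] 4 by (simp_all add: x_def y_def)
    have T: "mtranspose T = T'" "mtranspose T' = T"
      by (simp_all add: T_def T'_def mtranspose_twist) (simp add: twist_def)
    have z: "roy_mat a b (Suc (Suc i)) = mmul (mmul y T) x" by (simp add: x_def y_def T_def)
    have "mtranspose (roy_mat a b (Suc (Suc i))) = roy_mat a b (Suc (Suc i))"
      using less.IH[of "Suc (Suc i)"] 4 by simp
    hence z': "mmul (mmul y T) x = mmul x (mmul T' y)"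
      unfolding z by (simp add: mtranspose_mmul sym T)
    have "roy_mat a b k = mmul (mmul (mmul (mmul y T) x) T') y"
      unfolding 4 by (simp add: x_def y_def T_def T'_def)
    then show ?thesis by (simp add: mtranspose_mmul sym T mmul_assoc)
  qed (simp_all add: cf_mat_def)
qed

lemma mdet_roy_mat: "mdet (roy_mat a b k) = 1 \<or> mdet (roy_mat a b k) = - 1"
proof (induction a b k rule: roy_mat.induct)
  case (3 a b k)
  have "mdet (twist a b k) = 1"
    by (simp add: twist_def mdet_mmul) (simp add: cf_mat_def)
  with 3 show ?case by (auto simp: mdet_mmul)
qed (simp_all add: cf_mat_def)

text \<open>What makes three consecutive points independent is the lack of symmetry of the middle
  factor: for \<open>twist\<close> the difference t10 - t01 is a - b up to sign.\<close>

lemma det3_symmetric_matrices: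
  fixes p q s p' q' s' :: "'a::comm_ring_1"
  assumes "mmul (mmul (p', q', q', s') (t00, t01, t10, t11)) (p, q, q, s) = (P, Q, Q, S)"
  shows "det3 (p, q, s) (p', q', s') (P, Q, S)
    = mdet (p, q, q, s) * mdet (p', q', q', s') * (t10 - t01)"
proof -
  \<comment> \<open>Keeping the two off-diagonal entries apart turns the claim into a polynomial identity.\<close>
  define Q' where "Q' = Q"
  have e: "P = (p' * t00 + q' * t10) * p + (p' * t01 + q' * t11) * q"
    "Q = (p' * t00 + q' * t10) * q + (p' * t01 + q' * t11) * s"
    "Q' = (q' * t00 + s' * t10) * p + (q' * t01 + s' * t11) * q"
    "S = (q' * t00 + s' * t10) * q + (q' * t01 + s' * t11) * s"
    using assms by (auto simp: Q'_def)
  have "det3 (p, q, s) (p', q', s') (P, Q, S)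
      = (q * s' - s * q') * P + (s * p' - q * q') * Q' + (q * q' - p * s') * Q + (p * q' - q * p') * S"
    by (simp add: det3_def Q'_def algebra_simps)
  also have "\<dots> = mdet (p, q, q, s) * mdet (p', q', q', s') * (t10 - t01)"
    unfolding e by (simp add: algebra_simps)
  finally show ?thesis .
qed

lemma eq_0_if_dot_prods_eq_0:
  fixes n :: "'a::idom \<times> 'a \<times> 'a"
  assumes "dot_prod n x = 0" "dot_prod n y = 0" "dot_prod n z = 0" and "det3 x y z \<noteq> 0"
  shows "n = (0, 0, 0)"
proof (rule ccontr)
  assume "n \<noteq> (0, 0, 0)"
  have "cross_prod n (cross_prod x y) = (0, 0, 0)"
    using assms(1,2) by (rule cross_prod_cross_prod_eq_0)
  hence "cross_prod (cross_prod x y) n = (0, 0, 0)"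
    by (cases n; cases "cross_prod x y") (simp add: mult.commute)
  from dot_prod_eq_0_parallel[OF this \<open>n \<noteq> (0, 0, 0)\<close> assms(3)] assms(4)
  show False by (simp add: det3_def)
qed

text \<open>In logarithms the sequence obeys the Fibonacci recursion up to a bounded error, so ln (X
  (Suc k)) keeps a bounded distance from golden_ratio * ln (X k).\<close>

lemma golden_growth:
  fixes X :: "nat \<Rightarrow> real"
  assumes X: "\<And>k. X k \<ge> 1"
    and lower: "\<And>k. X (Suc k) * X k \<le> X (Suc (Suc k))"
    and upper: "\<And>k. X (Suc (Suc k)) \<le> E * (X (Suc k) * X k)"
  shows "\<exists>C>0. \<forall>k. 1 / X k \<le> C * X (Suc k) powr (- 1 / golden_ratio)"
proof -
  define \<sigma> where "\<sigma> = 1 / golden_ratio"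
  have \<sigma>: "\<sigma> > 1 / 2" "\<sigma> < 1" "\<sigma>\<^sup>2 = 1 - \<sigma>"
    unfolding \<sigma>_def by (rule inverse_golden_ratio)+
  have X0: "X k > 0" for k using X[of k] by linarith
  have Xne: "X k \<noteq> 0" for k using X0[of k] by simp
  have "1 * (X (Suc 0) * X 0) \<le> E * (X (Suc 0) * X 0)"
    using lower[of 0] upper[of 0] by linarith
  hence "E \<ge> 1" using X0[of 0] X0[of "Suc 0"] by simp
  define l where "l = (\<lambda>k. ln (X k))"
  \<comment> \<open>The first entry starts the induction; the second absorbs the error
    \<open>ln E\<close>, because \<sigma> \<le> 4/5 gives \<sigma> * (R + R / 4) \<le> R.\<close>
  define R where "R = max \<bar>\<sigma> * l (Suc 0) - l 0\<bar> (4 * ln E)"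
  have "ln E \<ge> 0" using \<open>E \<ge> 1\<close> by simp
  have R: "R \<ge> 0" "\<sigma> * R + ln E * \<sigma> \<le> R"
  proof -
    show "R \<ge> 0" by (simp add: R_def)
    have "\<sigma> * (R + ln E) \<le> \<sigma> * (R + R / 4)" using \<sigma> by (intro mult_left_mono) (auto simp: R_def)
    moreover have "\<sigma> * (5 / 4) \<le> 1"
    proof -
      have "\<sigma> * \<sigma> = 1 - \<sigma>" using \<sigma>(3) by (simp add: power2_eq_square)
      moreover have "(4 / 5) * (4 / 5) < \<sigma> * \<sigma>" if "\<sigma> > 4 / 5"
        using that by (intro mult_strict_mono) auto
      ultimately show ?thesis by (cases "\<sigma> > 4 / 5") auto
    qed
    hence "\<sigma> * (5 / 4) * R \<le> 1 * R" using \<open>R \<ge> 0\<close> by (intro mult_right_mono) auto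
    ultimately show "\<sigma> * R + ln E * \<sigma> \<le> R" by (simp add: algebra_simps)
  qed
  have l: "l (Suc k) + l k \<le> l (Suc (Suc k))" "l (Suc (Suc k)) \<le> ln E + l (Suc k) + l k" for k
  proof -
    have "ln (X (Suc k) * X k) \<le> l (Suc (Suc k))"
      using lower[of k] X0 unfolding l_def by (subst ln_le_cancel_iff) auto
    then show "l (Suc k) + l k \<le> l (Suc (Suc k))" by (simp add: l_def ln_mult X0 Xne)
    have "l (Suc (Suc k)) \<le> ln (E * (X (Suc k) * X k))"
      using upper[of k] X0 \<open>E \<ge> 1\<close> unfolding l_def by (subst ln_le_cancel_iff) auto
    then show "l (Suc (Suc k)) \<le> ln E + l (Suc k) + l k" using \<open>E \<ge> 1\<close> by (simp add: l_def ln_mult X0 Xne)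
  qed
  \<comment> \<open>Since \<open>1 - \<sigma> = \<sigma>\<^sup>2\<close>, the quantity \<open>\<sigma> * l (k + 1) - l k\<close> is multiplied by \<open>- \<sigma>\<close> in each step, up to
    a bounded error.\<close>
  have bound: "\<bar>\<sigma> * l (Suc k) - l k\<bar> \<le> R" for k
  proof (induction k)
    case 0
    then show ?case by (simp add: R_def)
  next
    case (Suc k)
    define \<epsilon> where "\<epsilon> = l (Suc (Suc k)) - l (Suc k) - l k"
    have \<epsilon>: "0 \<le> \<epsilon>" "\<epsilon> \<le> ln E" using l[of k] by (simp_all add: \<epsilon>_def)
    have "\<sigma> * l (Suc (Suc k)) - l (Suc k) = \<sigma> * \<epsilon> + \<sigma> * l k - (1 - \<sigma>) * l (Suc k)"
      by (simp add: \<epsilon>_def algebra_simps)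
    also have "\<dots> = \<sigma> * \<epsilon> - \<sigma> * (\<sigma> * l (Suc k) - l k)"
      unfolding \<sigma>(3)[symmetric] by (simp add: algebra_simps power2_eq_square)
    finally have "\<bar>\<sigma> * l (Suc (Suc k)) - l (Suc k)\<bar> \<le> \<bar>\<sigma> * \<epsilon>\<bar> + \<bar>\<sigma> * (\<sigma> * l (Suc k) - l k)\<bar>"
      by linarith
    also have "\<dots> \<le> ln E * \<sigma> + \<sigma> * R"
      using \<epsilon> \<sigma> Suc by (auto simp: abs_mult mult.commute[of "ln E"] intro!: add_mono mult_left_mono)
    finally show ?case using R by linarith
  qed
  have "1 / X k \<le> exp R * X (Suc k) powr (- \<sigma>)" for k
  proof -
    have "- l k \<le> R - \<sigma> * l (Suc k)" using bound[of k] by linarith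
    hence "exp (- l k) \<le> exp (R + (- \<sigma>) * l (Suc k))" by simp
    then show ?thesis using X0[of k] X0[of "Suc k"]
      by (simp add: l_def exp_minus powr_def exp_add exp_diff divide_inverse)
  qed
  then show ?thesis by (intro exI[of _ "exp R"]) (simp add: \<sigma>_def)
qed

context discrete_embedding begin

text \<open>
  Large partial quotients map this cone into itself, which controls the first entries of the matrix
  products both from below and from above.
\<close>

definition cone :: "'a \<Rightarrow> 'a \<Rightarrow> bool" where
  "cone u v \<longleftrightarrow> 2 * w (j v) \<le> w (j u)"

definition preserves_cone :: "'a mat2 \<Rightarrow> bool" where
  "preserves_cone M \<longleftrightarrow> (\<forall>u v. cone u v \<longrightarrow>
     (case M of (p, q, r, s) \<Rightarrow> cone (p * u + q * v) (r * u + s * v)))"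

lemma preserves_cone_mmul:
  assumes "preserves_cone M" "preserves_cone N"
  shows "preserves_cone (mmul M N)"
proof -
  obtain p q r s where M: "M = (p, q, r, s)" by (metis prod_cases4)
  obtain p' q' r' s' where N: "N = (p', q', r', s')" by (metis prod_cases4)
  show ?thesis unfolding preserves_cone_def
  proof (intro allI impI)
    fix u v assume "cone u v"
    hence "cone (p' * u + q' * v) (r' * u + s' * v)"
      using assms(2) by (auto simp: preserves_cone_def N)
    hence "cone (p * (p' * u + q' * v) + q * (r' * u + s' * v)) (r * (p' * u + q' * v) + s * (r' * u + s' * v))"
      using assms(1) by (auto simp: preserves_cone_def M)
    then show "case mmul M N of (p, q, r, s) \<Rightarrow> cone (p * u + q * v) (r * u + s * v)"
      by (simp add: M N algebra_simps)
  qed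
qed

lemma cf_step_ge:
  assumes "w (j a) \<ge> 3" and "cone u v"
  shows "w (j (a * u + v)) \<ge> 5 / 2 * w (j u)"
proof -
  have "w (j a * j u) \<le> w (j (a * u + v)) + w (j v)"
    using w_diff[of "j (a * u + v)" "j v"] by (simp add: j_simps)
  moreover have "3 * w (j u) \<le> w (j a) * w (j u)"
    using assms(1) by (intro mult_right_mono) auto
  ultimately show ?thesis using assms(2) by (simp add: cone_def w_mult)
qed

lemma cf_step_le:
  assumes "cone u v"
  shows "w (j (a * u + v)) \<le> (w (j a) + 1) * w (j u)"
proof -
  have "w (j (a * u + v)) \<le> w (j a) * w (j u) + w (j v)"
    using w_add[of "j a * j u" "j v"] by (simp add: j_simps w_mult)
  moreover have "w (j v) \<le> w (j u)" using assms w_nonneg[of "j v"] unfolding cone_def by linarith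
  ultimately show ?thesis by (simp add: algebra_simps)
qed

lemma preserves_cone_cf_mat:
  assumes "w (j a) \<ge> 3"
  shows "preserves_cone (cf_mat a)"
  unfolding preserves_cone_def
proof (intro allI impI)
  fix u v assume "cone u v"
  hence "2 * w (j u) \<le> w (j (a * u + v))"
    using cf_step_ge[OF assms \<open>cone u v\<close>] w_nonneg[of "j u"] by linarith
  then show "case cf_mat a of (p, q, r, s) \<Rightarrow> cone (p * u + q * v) (r * u + s * v)"
    by (simp add: cf_mat_def cone_def)
qed

lemma preserves_cone_roy_mat:
  assumes "w (j a) \<ge> 3" "w (j b) \<ge> 3"
  shows "preserves_cone (roy_mat a b k)"
  using assms
proof (induction a b k rule: roy_mat.induct)
  case (1 a b)
  then show ?case by (simp add: preserves_cone_def)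
next
  case (2 a b)
  then show ?case by (simp add: preserves_cone_cf_mat)
next
  case (3 a b k)
  have "preserves_cone (twist a b k)"
    using 3 by (auto simp: twist_def intro!: preserves_cone_mmul preserves_cone_cf_mat)
  with 3 show ?case by (auto intro!: preserves_cone_mmul)
qed

text \<open>Applying \<open>twist\<close> to the column (u, v) amounts to two continued fraction
  steps, each enlarging the first entry by a factor of at least 5/2, and (5/2)^2 > 4.\<close>

lemma twist_bounds:
  assumes "w (j a) \<ge> 3" "w (j b) \<ge> 3" and "cone u v" and "twist a b k = (t00, t01, t10, t11)"
  shows "w (j (t00 * u + t01 * v)) \<ge> 4 * w (j u)"
    and "w (j (t00 * u + t01 * v)) \<le> (w (j a) + 1) * (w (j b) + 1) * w (j u)"
    and "cone (t00 * u + t01 * v) (t10 * u + t11 * v)"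
proof -
  have main: "4 * w (j u) \<le> w (j (c * (d * u + v) + u)) \<and>
      w (j (c * (d * u + v) + u)) \<le> (w (j c) + 1) * (w (j d) + 1) * w (j u) \<and>
      cone (c * (d * u + v) + u) (d * u + v)"
    if cd: "w (j c) \<ge> 3" "w (j d) \<ge> 3" for c d
  proof -
    have 1: "w (j (d * u + v)) \<ge> 5 / 2 * w (j u)" using cf_step_ge[OF cd(2) assms(3)] .
    hence c1: "cone (d * u + v) u" unfolding cone_def using w_nonneg[of "j u"] by linarith
    have 2: "w (j (c * (d * u + v) + u)) \<ge> 5 / 2 * w (j (d * u + v))"
      using cf_step_ge[OF cd(1) c1] .
    have "w (j (c * (d * u + v) + u)) \<le> (w (j c) + 1) * w (j (d * u + v))"
      by (rule cf_step_le[OF c1])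
    also have "\<dots> \<le> (w (j c) + 1) * ((w (j d) + 1) * w (j u))"
      by (intro mult_left_mono cf_step_le assms(3)) auto
    finally have "w (j (c * (d * u + v) + u)) \<le> (w (j c) + 1) * (w (j d) + 1) * w (j u)"
      by (simp add: mult.assoc)
    moreover have "4 * w (j u) \<le> w (j (c * (d * u + v) + u))"
      "2 * w (j (d * u + v)) \<le> w (j (c * (d * u + v) + u))"
      using 1 2 w_nonneg[of "j u"] w_nonneg[of "j (d * u + v)"] by linarith+
    ultimately show ?thesis by (simp add: cone_def)
  qed
  show "w (j (t00 * u + t01 * v)) \<ge> 4 * w (j u)"
    "w (j (t00 * u + t01 * v)) \<le> (w (j a) + 1) * (w (j b) + 1) * w (j u)"
    "cone (t00 * u + t01 * v) (t10 * u + t11 * v)"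
    using main[of a b] main[of b a] assms(1,2,4)
    by (auto simp: twist_def cf_mat_def algebra_simps split: if_splits)
qed

theorem exists_uniform_exponent_inverse_golden_ratio:
  assumes big: "\<exists>g. w (j g) > 1"
    and complete: "\<And>\<rho> :: nat \<Rightarrow> 'c. (\<And>\<epsilon>. \<epsilon> > 0 \<Longrightarrow> \<exists>N. \<forall>m\<ge>N. \<forall>n\<ge>N. w (\<rho> m - \<rho> n) < \<epsilon>) \<Longrightarrow>
      \<exists>\<xi>. (\<lambda>n. w (\<rho> n - \<xi>)) \<longlonglongrightarrow> 0"
  shows "\<exists>\<xi>. (\<forall>a b c. j a + j b * \<xi> + j c * \<xi>\<^sup>2 = 0 \<longrightarrow> a = 0 \<and> b = 0 \<and> c = 0) \<and>
    (\<exists>c>0. \<forall>X\<ge>1. \<exists>x. x \<noteq> (0, 0, 0) \<and> height x \<le> X \<and> err \<xi> x \<le> c * X powr (- 1 / golden_ratio))"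
proof -

  \<comment> \<open>Partial quotients and matrix entries\<close>
  obtain g where g: "w (j g) > 1" using big by blast
  obtain n where n: "w (j g) ^ n > 3" using real_arch_pow[OF g] by blast
  define a where "a = g ^ n"
  define b where "b = a\<^sup>2" \<comment> \<open>any \<open>b \<noteq> a\<close> with \<open>w (j b) \<ge> 3\<close> would do\<close>
  have a: "w (j a) > 3" using n by (simp add: a_def j_simps w_power)
  have "w (j b) = w (j a) * w (j a)" by (simp add: b_def j_simps w_mult power2_eq_square)
  also have "\<dots> > 1 * w (j a)" using a by (intro mult_strict_right_mono) auto
  finally have ba: "w (j b) > w (j a)" by simp
  hence "a \<noteq> b" by fastforce
  have ab: "w (j a) \<ge> 3" "w (j b) \<ge> 3" using a ba by linarith+

  define p q s where "p = (\<lambda>k. fst (roy_mat a b k))" and "q = (\<lambda>k. fst (snd (roy_mat a b k)))"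
    and "s = (\<lambda>k. snd (snd (snd (roy_mat a b k))))"
  have roy: "roy_mat a b k = (p k, q k, q k, s k)" for k
  proof -
    obtain P Q R S where M: "roy_mat a b k = (P, Q, R, S)" by (metis prod_cases4)
    have "Q = R" using mtranspose_roy_mat[of a b k] unfolding M mtranspose.simps prod.inject by blast
    then show ?thesis unfolding p_def q_def s_def M by simp
  qed
  have det: "p k * s k - q k * q k = 1 \<or> p k * s k - q k * q k = - 1" for k
    using mdet_roy_mat[of a b k] by (simp add: roy)
  have wdet: "w (j (p k * s k - q k * q k)) = 1" for k
    using det[of k] by (auto simp del: right_diff_distrib left_diff_distrib simp: j_minus j_one)
  have cone: "cone (p k) (q k)" for k
  proof -
    have "cone 1 0" by (simp add: cone_def)
    then show ?thesis using preserves_cone_roy_mat[OF ab, of k] unfolding preserves_cone_def roy by fastforce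
  qed
  have pnz: "p k \<noteq> 0" for k
  proof
    assume "p k = 0"
    moreover from this have "q k = 0" using cone[of k] by (simp add: cone_def)
    ultimately show False using det[of k] by simp
  qed
  define X where "X = (\<lambda>k. w (j (p k)))"
  have X1: "X k \<ge> 1" for k using discrete[OF pnz] by (simp add: X_def)
  have X0: "X k > 0" for k using X1[of k] by linarith

  \<comment> \<open>Growth of the first entries and convergence of the ratios\<close>
  define E where "E = 2 * ((w (j a) + 1) * (w (j b) + 1))"
  define \<rho> where "\<rho> = (\<lambda>k. j (q k) / j (p k))"

  have step: "3 * (X (Suc k) * X k) \<le> X (Suc (Suc k)) \<and> X (Suc (Suc k)) \<le> E * (X (Suc k) * X k)
      \<and> w (\<rho> (Suc (Suc k)) - \<rho> (Suc k)) \<le> 1 / (X (Suc k))\<^sup>2" for k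
  proof -
    obtain t00 t01 t10 t11 where T: "twist a b k = (t00, t01, t10, t11)" by (metis prod_cases4)
    \<comment> \<open>(t0, t1) is \<open>twist\<close> applied to the first column of the matrix
      with index k. In the first entry of the matrix with index k + 2 the summand with t1 is at most
      a quarter of the one with t0, two cone conditions giving a factor 1/2 each.\<close>
    define t0 t1 where "t0 = t00 * p k + t01 * q k" and "t1 = t10 * p k + t11 * q k"
    note tb = twist_bounds[OF ab cone[of k] T, folded t0_def t1_def]
    have rec: "p (Suc (Suc k)) = p (Suc k) * t0 + q (Suc k) * t1"
      "q (Suc (Suc k)) = q (Suc k) * t0 + s (Suc k) * t1"
      using roy[of "Suc (Suc k)"] roy[of "Suc k"] roy[of k] T
      by (auto simp: t0_def t1_def algebra_simps)
    have qt: "w (j (q (Suc k) * t1)) \<le> 1 / 4 * (X (Suc k) * w (j t0))"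
    proof -
      have "w (j (q (Suc k))) * w (j t1) \<le> (1 / 2 * X (Suc k)) * (1 / 2 * w (j t0))"
        using cone[of "Suc k"] tb(3) by (intro mult_mono) (auto simp: cone_def X_def)
      then show ?thesis by (simp add: j_simps w_mult)
    qed
    have pt: "w (j (p (Suc k) * t0)) = X (Suc k) * w (j t0)" by (simp add: X_def j_simps w_mult)
    have lo: "3 / 4 * (X (Suc k) * w (j t0)) \<le> X (Suc (Suc k))"
      using w_diff[of "j (p (Suc (Suc k)))" "j (q (Suc k) * t1)"] qt pt
      by (simp add: rec X_def j_add)
    have up: "X (Suc (Suc k)) \<le> 5 / 4 * (X (Suc k) * w (j t0))"
      using w_add[of "j (p (Suc k) * t0)" "j (q (Suc k) * t1)"] qt pt
      by (simp add: rec X_def j_add)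
    have "4 * (X (Suc k) * X k) \<le> X (Suc k) * w (j t0)"
      using mult_left_mono[OF tb(1), of "X (Suc k)"] X0[of "Suc k"] by (simp add: X_def ac_simps)
    hence 1: "3 * (X (Suc k) * X k) \<le> X (Suc (Suc k))" using lo by linarith
    have "X (Suc k) * w (j t0) \<le> X (Suc k) * (((w (j a) + 1) * (w (j b) + 1)) * X k)"
      using tb(2) X0[of "Suc k"] by (intro mult_left_mono) (auto simp: X_def)
    also have "\<dots> = 1 / 2 * (E * (X (Suc k) * X k))" by (simp add: E_def ac_simps)
    finally have "X (Suc k) * w (j t0) \<le> 1 / 2 * (E * (X (Suc k) * X k))" .
    moreover have "0 \<le> E * (X (Suc k) * X k)"
      using X0[of k] X0[of "Suc k"] by (simp add: E_def)
    ultimately have 2: "X (Suc (Suc k)) \<le> E * (X (Suc k) * X k)" using up by linarith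
    have "t0 \<noteq> 0" using tb(1) X0[of k] by (auto simp: X_def)
    hence t0: "w (j t0) > 0" using discrete[of t0] by linarith
    \<comment> \<open>Over the common denominator, the numerator is t1 times the determinant of the
      matrix with index k + 1, which is \<plusminus>1; hence the quadratic quality of the
      approximation.\<close>
    have \<rho>_diff: "\<rho> (Suc (Suc k)) - \<rho> (Suc k)
      = j ((p (Suc k) * s (Suc k) - q (Suc k) * q (Suc k)) * t1) / (j (p (Suc k)) * j (p (Suc (Suc k))))"
      using pnz[of "Suc k"] pnz[of "Suc (Suc k)"]
      by (simp add: \<rho>_def divide_simps) (simp add: rec j_simps algebra_simps)
    have "w (\<rho> (Suc (Suc k)) - \<rho> (Suc k)) = w (j t1) / (X (Suc k) * X (Suc (Suc k)))"
      unfolding \<rho>_diff w_divide j_mult w_mult wdet X_def by simp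
    also have "\<dots> \<le> w (j t1) / (X (Suc k) * (3 / 4 * (X (Suc k) * w (j t0))))"
      using lo X0[of "Suc k"] X0[of "Suc (Suc k)"] t0
      by (intro divide_left_mono mult_left_mono mult_pos_pos) auto
    also have "\<dots> \<le> w (j t0) / (X (Suc k) * (X (Suc k) * w (j t0)))"
    proof -
      have "4 / 3 * w (j t1) \<le> w (j t0)" using tb(3) t0 unfolding cone_def by linarith
      hence "4 / 3 * w (j t1) / (X (Suc k) * (X (Suc k) * w (j t0)))
          \<le> w (j t0) / (X (Suc k) * (X (Suc k) * w (j t0)))"
        using X0[of "Suc k"] t0 by (intro divide_right_mono) auto
      then show ?thesis by simp
    qed
    also have "\<dots> = 1 / (X (Suc k))\<^sup>2" using \<open>t0 \<noteq> 0\<close> by (simp add: power2_eq_square)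
    finally show ?thesis using 1 2 by blast
  qed
  have X_0: "X 0 = 1" and q_0: "q 0 = 0" and X_1: "X (Suc 0) = w (j a)"
    using roy[of 0] roy[of "Suc 0"] by (auto simp: X_def cf_mat_def j_one)
  have q_1: "q (Suc 0) = 1" using roy[of "Suc 0"] by (simp add: cf_mat_def)
  have diff: "w (\<rho> (Suc k) - \<rho> k) \<le> 1 / (X k)\<^sup>2" for k
  proof (cases k)
    case 0
    have "w (\<rho> (Suc 0) - \<rho> 0) = 1 / X (Suc 0)"
      by (simp add: \<rho>_def q_0 q_1 X_def j_one w_divide)
    also have "\<dots> \<le> 1" using X1[of "Suc 0"] by simp
    finally show ?thesis by (simp add: 0 X_0)
  qed (use step in blast)
  have grow: "2 * X k \<le> X (Suc k)" for k
  proof (cases k)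
    case (Suc i)
    have "X (Suc i) * 1 \<le> X (Suc i) * X i" using X1[of i] X0[of "Suc i"] by (intro mult_left_mono) auto
    then show ?thesis using step[of i] X0[of "Suc i"] unfolding Suc by linarith
  qed (use a X_0 X_1 in simp)
  \<comment> \<open>The subtracted term makes the induction close: as X at least doubles, 1 / X^2 is
    at most the decrease of 2 / X^2 over one step.\<close>
  have tail: "w (\<rho> (k + i) - \<rho> k) \<le> 2 / (X k)\<^sup>2 - 2 / (X (k + i))\<^sup>2" for k i
  proof (induction i)
    case 0
    then show ?case by simp
  next
    case (Suc i)
    have "w (\<rho> (k + Suc i) - \<rho> k) \<le> w (\<rho> (k + Suc i) - \<rho> (k + i)) + w (\<rho> (k + i) - \<rho> k)"
      using w_add[of "\<rho> (k + Suc i) - \<rho> (k + i)" "\<rho> (k + i) - \<rho> k"] by simp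
    also have "\<dots> \<le> 1 / (X (k + i))\<^sup>2 + (2 / (X k)\<^sup>2 - 2 / (X (k + i))\<^sup>2)"
      using diff[of "k + i"] Suc by (intro add_mono) auto
    also have "1 / (X (k + i))\<^sup>2 \<le> 2 / (X (k + i))\<^sup>2 - 2 / (X (k + Suc i))\<^sup>2"
    proof -
      have "(2 * X (k + i))\<^sup>2 \<le> (X (Suc (k + i)))\<^sup>2"
        using grow[of "k + i"] X0[of "k + i"] by (intro power_mono) auto
      hence "2 / (X (Suc (k + i)))\<^sup>2 \<le> 2 / (2 * X (k + i))\<^sup>2"
        using X0[of "k + i"] X0[of "Suc (k + i)"] by (intro divide_left_mono mult_pos_pos) auto
      also have "\<dots> \<le> 1 / (X (k + i))\<^sup>2" using X0[of "k + i"] by (simp add: field_simps)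
      finally have "2 / (X (Suc (k + i)))\<^sup>2 \<le> 1 / (X (k + i))\<^sup>2" .
      moreover have "2 / (X (k + i))\<^sup>2 = 2 * (1 / (X (k + i))\<^sup>2)" by simp
      ultimately show ?thesis unfolding add_Suc_right by linarith
    qed
    finally show ?case by simp
  qed
  have tail': "w (\<rho> (k + i) - \<rho> k) \<le> 2 / (X k)\<^sup>2" for k i
    using tail[of k i] by (rule order_trans) simp
  have Xpow: "2 ^ k \<le> X k" for k
  proof (induction k)
    case (Suc k)
    then show ?case using grow[of k] by simp
  qed (simp add: X_0)
  have inv_lim: "(\<lambda>k. C / X k) \<longlonglongrightarrow> 0" if "C \<ge> 0" for C
  proof (rule tendsto_sandwich)
    show "\<forall>\<^sub>F k in sequentially. 0 \<le> C / X k"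
      using X0 that by (auto intro!: always_eventually divide_nonneg_pos)
    show "\<forall>\<^sub>F k in sequentially. C / X k \<le> C * (1 / 2) ^ k"
    proof (intro always_eventually allI)
      fix k
      have "C / X k \<le> C / 2 ^ k" using Xpow[of k] X0[of k] that by (intro divide_left_mono) auto
      then show "C / X k \<le> C * (1 / 2) ^ k" by (simp add: power_divide)
    qed
    have "(\<lambda>k. C * (1 / 2) ^ k) \<longlonglongrightarrow> C * 0"
      by (intro tendsto_intros LIMSEQ_power_zero) simp
    then show "(\<lambda>k. C * (1 / 2) ^ k) \<longlonglongrightarrow> 0" by simp
  qed simp
  have sq: "2 / (X k)\<^sup>2 \<le> 2 / X k" for k
    using X1[of k] X0[of k] self_le_power[of "X k" 2] by (intro divide_left_mono) auto

  \<comment> \<open>The limit of the ratios\<close>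
  have "\<exists>N. \<forall>m\<ge>N. \<forall>n\<ge>N. w (\<rho> m - \<rho> n) < \<epsilon>" if "\<epsilon> > 0" for \<epsilon>
  proof -
    have "\<forall>\<^sub>F k in sequentially. 4 / X k < \<epsilon>"
      using inv_lim[of 4] that by (intro order_tendstoD(2)) auto
    then obtain N where N: "4 / X N < \<epsilon>" by (auto simp: eventually_sequentially)
    have near: "w (\<rho> m - \<rho> N) \<le> 2 / X N" if "m \<ge> N" for m
      using order_trans[OF tail'[of N "m - N"] sq[of N]] that by simp
    have "w (\<rho> m - \<rho> n) < \<epsilon>" if "m \<ge> N" "n \<ge> N" for m n
    proof -
      have "w (\<rho> m - \<rho> n) \<le> w (\<rho> m - \<rho> N) + w (\<rho> n - \<rho> N)"
        using w_diff[of "\<rho> m - \<rho> N" "\<rho> n - \<rho> N"] by simp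
      then show ?thesis using near[OF that(1)] near[OF that(2)] N by simp
    qed
    then show ?thesis by blast
  qed
  then obtain \<xi> where lim: "(\<lambda>n. w (\<rho> n - \<xi>)) \<longlonglongrightarrow> 0"
    using complete[of \<rho>] by blast
  have dist: "w (\<xi> - \<rho> k) \<le> 2 / (X k)\<^sup>2" for k
  proof -
    have "(\<lambda>i. 2 / (X k)\<^sup>2 + w (\<rho> (i + k) - \<xi>)) \<longlonglongrightarrow> 2 / (X k)\<^sup>2 + 0"
      by (intro tendsto_intros LIMSEQ_ignore_initial_segment[OF lim])
    moreover have "w (\<xi> - \<rho> k) \<le> 2 / (X k)\<^sup>2 + w (\<rho> (i + k) - \<xi>)" for i
      using w_diff[of "\<rho> (i + k) - \<rho> k" "\<rho> (i + k) - \<xi>"] tail'[of k i] by (simp add: add.commute)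
    ultimately have "w (\<xi> - \<rho> k) \<le> 2 / (X k)\<^sup>2 + 0"
      by (intro tendsto_lowerbound[of _ _ sequentially]) (auto intro: always_eventually)
    then show ?thesis by simp
  qed
  \<comment> \<open>This bound and the next give w (\<xi> + \<rho> k) \<le> 3, a factor in the error
    of the second coordinate.\<close>
  have \<rho>_le: "w (\<rho> k) \<le> 1 / 2" for k
    using cone[of k] X0[of k] by (simp add: \<rho>_def w_divide cone_def X_def field_simps)
  have \<xi>_le: "w \<xi> \<le> 5 / 2"
    using w_add[of "\<xi> - \<rho> 0" "\<rho> 0"] dist[of 0] \<rho>_le[of 0] by (simp add: X_0)

  \<comment> \<open>The approximating points and their errors\<close>
  define y where "y = (\<lambda>k. (p k, q k, s k))"
  have ynz: "y k \<noteq> (0, 0, 0)" for k using pnz by (simp add: y_def)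
  have yh: "height (y k) = X k" for k by (simp add: y_def height_def X_def)
  have yerr: "err \<xi> (y k) \<le> 7 / X k" for k
  proof -
    have Xd: "X k * (C * (2 / (X k)\<^sup>2)) = 2 * C / X k" for C
      using X0[of k] by (simp add: power2_eq_square)
    have pz: "j (p k) \<noteq> 0" using pnz by simp
    have "j (p k) * \<xi> - j (q k) = j (p k) * (\<xi> - \<rho> k)" using pz by (simp add: \<rho>_def field_simps)
    hence "w (j (p k) * \<xi> - j (q k)) = X k * w (\<xi> - \<rho> k)" by (simp add: w_mult X_def)
    also have "\<dots> \<le> X k * (1 * (2 / (X k)\<^sup>2))"
      using dist[of k] X0[of k] by (intro mult_left_mono) auto
    also have "\<dots> \<le> 7 / X k" unfolding Xd using X0[of k] by (simp add: divide_right_mono)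
    finally have 1: "w (j (p k) * \<xi> - j (q k)) \<le> 7 / X k" .
    \<comment> \<open>Since p * s = q^2 + D, the error p * \<xi>^2 - s is p * (\<xi>^2 - \<rho>^2)
      less a term of size 1 / X; the two contribute 6 and 1 to the constant 7.\<close>
    define D where "D = p k * s k - q k * q k"
    have "j (p k) * \<xi>\<^sup>2 - j (s k) = j (p k) * ((\<xi> + \<rho> k) * (\<xi> - \<rho> k)) - j D / j (p k)"
      using pz by (simp add: \<rho>_def D_def j_simps field_simps power2_eq_square)
    hence "w (j (p k) * \<xi>\<^sup>2 - j (s k)) \<le> X k * (w (\<xi> + \<rho> k) * w (\<xi> - \<rho> k)) + w (j D) / X k"
      using w_diff[of "j (p k) * ((\<xi> + \<rho> k) * (\<xi> - \<rho> k))" "j D / j (p k)"]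
      by (simp add: w_mult w_divide X_def)
    also have "w (j D) = 1" unfolding D_def by (rule wdet)
    also have "X k * (w (\<xi> + \<rho> k) * w (\<xi> - \<rho> k)) \<le> X k * (3 * (2 / (X k)\<^sup>2))"
      using w_add[of \<xi> "\<rho> k"] \<xi>_le \<rho>_le[of k] dist[of k] X0[of k]
      by (intro mult_left_mono mult_mono) auto
    also have "\<dots> = 6 / X k" unfolding Xd by simp
    finally have 2: "w (j (p k) * \<xi>\<^sup>2 - j (s k)) \<le> 7 / X k" by (simp add: add_divide_distrib[symmetric])
    show ?thesis using 1 2 by (simp add: err_def y_def)
  qed

  \<comment> \<open>Linear independence of 1, \<xi> and \<xi>^2\<close>
  have indep: "a0 = 0 \<and> a1 = 0 \<and> a2 = 0" if rel: "j a0 + j a1 * \<xi> + j a2 * \<xi>\<^sup>2 = 0" for a0 a1 a2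
  proof -
    define D where "D = (w (j a1) + w (j a2)) * 7"
    have "(\<lambda>k. D / X k) \<longlonglongrightarrow> 0" by (rule inv_lim) (simp add: D_def)
    then obtain K where K: "\<And>k. k \<ge> K \<Longrightarrow> D / X k < 1"
      using order_tendstoD(2)[of _ 0 sequentially 1] eventually_sequentially by (metis zero_less_one)
    \<comment> \<open>The relation, evaluated at \<open>y k\<close>, takes values in A of absolute
      value below 1, so it vanishes there; three independent points then force its coefficients to
      be 0.\<close>
    have dot: "dot_prod (a0, a1, a2) (y k) = 0" if "k \<ge> K" for k
    proof (rule eq_0_if_small)
      have "w (j (dot_prod (a0, a1, a2) (y k))) \<le> (w (j a1) + w (j a2)) * err \<xi> (y k)"
        using linear_form_approx[of "y k" a0 a1 \<xi> a2] rel by simp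
      also have "\<dots> \<le> (w (j a1) + w (j a2)) * (7 / X k)"
        by (intro mult_left_mono yerr) simp
      also have "\<dots> = D / X k" by (simp add: D_def)
      finally show "w (j (dot_prod (a0, a1, a2) (y k))) < 1" using K[OF that] by linarith
    qed
    obtain t00 t01 t10 t11 where T: "twist a b K = (t00, t01, t10, t11)" by (metis prod_cases4)
    have "t10 - t01 \<noteq> 0"
      using T \<open>a \<noteq> b\<close> by (auto simp: twist_def cf_mat_def split: if_splits)
    have "mmul (mmul (p (Suc K), q (Suc K), q (Suc K), s (Suc K)) (t00, t01, t10, t11)) (p K, q K, q K, s K)
        = (p (Suc (Suc K)), q (Suc (Suc K)), q (Suc (Suc K)), s (Suc (Suc K)))"
      unfolding roy[symmetric] T[symmetric] by simp
    from det3_symmetric_matrices[OF this]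
    have "det3 (y K) (y (Suc K)) (y (Suc (Suc K))) \<noteq> 0"
      using det[of K] det[of "Suc K"] \<open>t10 - t01 \<noteq> 0\<close> by (auto simp: y_def)
    from eq_0_if_dot_prods_eq_0[OF dot dot dot this]
    show ?thesis by simp
  qed

  \<comment> \<open>Solutions for every bound\<close>
  have "X (Suc k) * X k \<le> X (Suc (Suc k))" for k
    using step[of k] mult_pos_pos[OF X0[of "Suc k"] X0[of k]] by linarith
  then obtain C where C: "C > 0" "\<And>k. 1 / X k \<le> C * X (Suc k) powr (- 1 / golden_ratio)"
    using golden_growth[of X E] X1 step by blast
  have sol: "\<exists>x. x \<noteq> (0, 0, 0) \<and> height x \<le> Z \<and> err \<xi> x \<le> (7 * C) * Z powr (- 1 / golden_ratio)"
    if "Z \<ge> 1" for Z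
  proof -
    obtain N where "Z < 2 ^ N" using real_arch_pow[of 2 Z] by auto
    hence "Z < X N" using Xpow[of N] by linarith
    \<comment> \<open>For X k \<le> Z < X (Suc k) the point \<open>y k\<close> is low enough, and
      its error is bounded by a multiple of X (Suc k) powr (- 1 / golden_ratio), hence of the same
      power of \<open>Z\<close>. As X 0 = 1 \<le> Z, the least index \<open>K\<close> is
      positive.\<close>
    define K where "K = (LEAST N. Z < X N)"
    have "Z < X K" unfolding K_def using \<open>Z < X N\<close> by (rule LeastI)
    have "K \<noteq> 0" using \<open>Z < X K\<close> that X_0 by (intro notI) simp
    then obtain k where k: "K = Suc k" by (cases K) auto
    have "X k \<le> Z" using not_less_Least[of k "\<lambda>N. Z < X N"] k by (simp add: K_def)
    have "err \<xi> (y k) \<le> 7 * (1 / X k)" using yerr[of k] by simp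
    also have "\<dots> \<le> 7 * (C * X (Suc k) powr (- 1 / golden_ratio))"
      by (intro mult_left_mono C) simp
    also have "\<dots> \<le> 7 * (C * Z powr (- 1 / golden_ratio))"
      using \<open>Z < X K\<close> k that C(1)
      by (intro mult_left_mono powr_mono2') (auto simp: golden_ratio_def intro: add_nonneg_nonneg)
    finally show ?thesis using ynz[of k] \<open>X k \<le> Z\<close> by (intro exI[of _ "y k"]) (simp add: yh)
  qed
  have "\<exists>c>0. \<forall>X\<ge>1. \<exists>x. x \<noteq> (0, 0, 0) \<and> height x \<le> X \<and> err \<xi> x \<le> c * X powr (- 1 / golden_ratio)"
    by (intro exI[of _ "7 * C"] conjI allI impI sol) (use C(1) in simp)
  with indep show ?thesis by blast
qed

end

section \<open>Transfer to the field of fractions and its completion\<close>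

theorem mainTheorem1:
  fixes v :: "'a::idom fract \<Rightarrow> real"
    and \<iota> :: "'a fract \<Rightarrow> 'c::field"
    and w :: "'c \<Rightarrow> real"
  assumes "nontrivial_absolute_value v"
    and "\<And>a::'a. a \<noteq> 0 \<Longrightarrow> v (to_fract a) \<ge> 1"
    and "completion_of v \<iota> w"
  shows "(unique_factorization_domain TYPE('a) \<longrightarrow>
           (\<forall>\<xi>. lin_indep_1_xi_xi2 \<iota> \<xi> \<longrightarrow>
             (\<exists>c1>0. \<forall>B. \<exists>X>0. X \<ge> B \<and> \<not> has_nonzero_solution \<iota> w \<xi> c1 X))) \<and>
         (\<exists>\<xi>. lin_indep_1_xi_xi2 \<iota> \<xi> \<and>
           (\<exists>c2>0. \<exists>X0>0. \<forall>X\<ge>X0. has_nonzero_solution \<iota> w \<xi> c2 X))"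
proof -
  define j :: "'a \<Rightarrow> 'c" where "j = (\<lambda>a. \<iota> (to_fract a))"
  have \<iota>: "\<iota> 1 = 1" "\<And>x y. \<iota> (x + y) = \<iota> x + \<iota> y" "\<And>x y. \<iota> (x * y) = \<iota> x * \<iota> y"
    and abs: "absolute_value w" and wv: "\<And>x. w (\<iota> x) = v x"
    and comp: "Metric_space.mcomplete UNIV (\<lambda>y z. w (y - z))"
    using assms(3) unfolding completion_of_def field_embedding_def by blast+
  interpret discrete_embedding j w
    by unfold_locales (use \<iota> abs wv assms(2) in \<open>auto simp: j_def\<close>)
  have sol_iff: "has_nonzero_solution \<iota> w \<xi> c X \<longleftrightarrow>
      (\<exists>x. x \<noteq> (0, 0, 0) \<and> height x \<le> X \<and> err \<xi> x \<le> c * X powr (- 1 / golden_ratio))" for \<xi> c X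
    unfolding has_nonzero_solution_def height_def err_def split_paired_Ex fst_conv snd_conv
    unfolding j_def ..
  have indep_iff: "lin_indep_1_xi_xi2 \<iota> \<xi> \<longleftrightarrow>
      (\<forall>a b c. j a + j b * \<xi> + j c * \<xi>\<^sup>2 = 0 \<longrightarrow> a = 0 \<and> b = 0 \<and> c = 0)" for \<xi>
  proof
    assume "lin_indep_1_xi_xi2 \<iota> \<xi>"
    then show "\<forall>a b c. j a + j b * \<xi> + j c * \<xi>\<^sup>2 = 0 \<longrightarrow> a = 0 \<and> b = 0 \<and> c = 0"
      unfolding lin_indep_1_xi_xi2_def j_def by (metis mult_1_right to_fract_eq_0_iff)
  next
    assume R: "\<forall>a b c. j a + j b * \<xi> + j c * \<xi>\<^sup>2 = 0 \<longrightarrow> a = 0 \<and> b = 0 \<and> c = 0"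
    show "lin_indep_1_xi_xi2 \<iota> \<xi>"
      unfolding lin_indep_1_xi_xi2_def
    proof (intro allI impI)
      fix a b c :: "'a fract"
      assume eq: "\<iota> a * 1 + \<iota> b * \<xi> + \<iota> c * \<xi>\<^sup>2 = 0"
      obtain a1 a2 where a: "a = Fract a1 a2" "a2 \<noteq> 0" by (rule Fract_cases)
      obtain b1 b2 where b: "b = Fract b1 b2" "b2 \<noteq> 0" by (rule Fract_cases)
      obtain c1 c2 where c: "c = Fract c1 c2" "c2 \<noteq> 0" by (rule Fract_cases)
      \<comment> \<open>A common denominator turns a relation over K into one over A.\<close>
      define d where "d = to_fract (a2 * b2 * c2)"
      have "d * a = to_fract (a1 * b2 * c2)" "d * b = to_fract (b1 * a2 * c2)" "d * c = to_fract (c1 * a2 * b2)"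
        using a b c by (simp_all add: d_def Fract_conv_to_fract field_simps)
      hence "j (a1 * b2 * c2) + j (b1 * a2 * c2) * \<xi> + j (c1 * a2 * b2) * \<xi>\<^sup>2
          = \<iota> d * (\<iota> a * 1 + \<iota> b * \<xi> + \<iota> c * \<xi>\<^sup>2)"
        unfolding j_def by (metis (no_types, opaque_lifting) \<iota>(3) distrib_left mult.assoc mult_1_right)
      hence "a1 * b2 * c2 = 0 \<and> b1 * a2 * c2 = 0 \<and> c1 * a2 * b2 = 0"
        unfolding eq mult_zero_right using R by blast
      then show "a = 0 \<and> b = 0 \<and> c = 0"
        using a b c by (simp add: Fract_conv_to_fract)
    qed
  qed
  \<comment> \<open>An element of absolute value other than 1 has a numerator or a denominator of
    absolute value other than 1, hence greater than 1.\<close>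
  have "\<exists>g. w (j g) > 1"
  proof -
    have v: "v (x * y) = v x * v y" "v x \<ge> 0" "v x = 0 \<longleftrightarrow> x = 0" for x y
      using assms(1) unfolding nontrivial_absolute_value_def absolute_value_def by blast+
    obtain x where x: "x \<noteq> 0" "v x \<noteq> 1"
      using assms(1) unfolding nontrivial_absolute_value_def by blast
    obtain x1 x2 where x12: "x = Fract x1 x2" "x2 \<noteq> 0" by (rule Fract_cases)
    have "x1 \<noteq> 0" using x(1) x12 by (auto simp: Fract_conv_to_fract)
    have "x * to_fract x2 = to_fract x1" using x12 by (simp add: Fract_conv_to_fract)
    hence "v x * v (to_fract x2) = v (to_fract x1)" by (metis v(1))
    hence "v (to_fract x1) \<noteq> 1 \<or> v (to_fract x2) \<noteq> 1" using x(2) by auto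
    hence "v (to_fract x1) > 1 \<or> v (to_fract x2) > 1"
      using assms(2)[OF \<open>x1 \<noteq> 0\<close>] assms(2)[OF x12(2)] by linarith
    then show ?thesis unfolding j_def wv by blast
  qed
  moreover have "\<exists>\<xi>. (\<lambda>n. w (\<rho> n - \<xi>)) \<longlonglongrightarrow> 0"
    if cauchy: "\<And>\<epsilon>. \<epsilon> > 0 \<Longrightarrow> \<exists>N. \<forall>m\<ge>N. \<forall>n\<ge>N. w (\<rho> m - \<rho> n) < \<epsilon>" for \<rho> :: "nat \<Rightarrow> 'c"
  proof -
    interpret M: Metric_space UNIV "\<lambda>y z. w (y - z)"
    proof
      fix x y z :: 'c
      show "w (x - y) = w (y - x)" using w_minus[of "x - y"] by simp
      show "w (x - z) \<le> w (x - y) + w (y - z)" using w_add[of "x - y" "y - z"] by simp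
    qed auto
    have "M.MCauchy \<rho>" unfolding M.MCauchy_def using cauchy by auto
    then obtain \<xi> where "limitin M.mtopology \<rho> \<xi> sequentially"
      using comp unfolding M.mcomplete_def by blast
    then have "(\<lambda>n. w (\<rho> n - \<xi>)) \<longlonglongrightarrow> 0"
      unfolding M.limit_metric_sequentially by (auto simp: LIMSEQ_iff)
    then show ?thesis ..
  qed
  ultimately obtain \<xi> c where \<xi>: "\<forall>a b c. j a + j b * \<xi> + j c * \<xi>\<^sup>2 = 0 \<longrightarrow> a = 0 \<and> b = 0 \<and> c = 0"
    and c: "c > 0" "\<forall>X\<ge>1. \<exists>x. x \<noteq> (0, 0, 0) \<and> height x \<le> X \<and> err \<xi> x \<le> c * X powr (- 1 / golden_ratio)"
    using exists_uniform_exponent_inverse_golden_ratio by blast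
  have "\<exists>\<xi>. lin_indep_1_xi_xi2 \<iota> \<xi> \<and> (\<exists>c2>0. \<exists>X0>0. \<forall>X\<ge>X0. has_nonzero_solution \<iota> w \<xi> c2 X)"
    unfolding indep_iff sol_iff using \<xi> c zero_less_one by blast
  moreover have "\<exists>c1>0. \<forall>B. \<exists>X>0. X \<ge> B \<and> \<not> has_nonzero_solution \<iota> w \<xi> c1 X"
    if "unique_factorization_domain TYPE('a)" and "lin_indep_1_xi_xi2 \<iota> \<xi>" for \<xi>
    unfolding sol_iff
    by (rule uniform_exponent_le_inverse_golden_ratio[OF that(1)]) (use that(2) indep_iff in blast)
  ultimately show ?thesis by blast
qed

end
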